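(* For the single network core coflow scheduling problem with precedence constraints (and arbitrary release times), the algorithm single-network-core-list-scheduling has an approximation ratio of at most $5\mu$ for minimizing the total weighted coflow completion time $\sum_{k\in\mathcal{K}} w_kC_k$, where $\mu$ is the maximum number of coflows on a directed path of the precedence graph.
   Context: Single network core: one $N\times N$ non-blocking switch with input ports $i\in\mathcal{I}=\{1,\dots,N\}$ (source servers) and output ports $j\in\mathcal{J}=\{1,\dots,N\}$ (destination servers), all links of unit capacity. An instance is a finite set $\mathcal{K}$ of coflows; coflow $k$ has a demand matrix $(d_{ijk})_{i,j=1}^N$ of nonnegative integers, a release time $r_k\ge0$ and a nonnegative weight $w_k$. A flow is a triple $(i,j,k)$ with $d_{ijk}>0$, i.e. $d_{ijk}$ units of data from input $i$ to output $j$. At every time each input port sends at total rate at most $1$ and each output port receives at total rate at most $1$; no data of coflow $k$ is sent before $r_k$. Precedence constraints are given by a directed acyclic graph $G=(\mathcal{K},E)$: if $(k',k)\in E$ (written $k'\prec k$), no flow of $k$ may be transmitted before all flows of $k'$ have completed; a flow/coflow is ready once all flows of all its predecessor coflows have completed. The completion time $C_k$ of coflow $k$ is the completion time of its last flow. $\mu$ is the maximum number of coflows on a directed path in $G$. An algorithm has approximation ratio at most $\alpha$ if on every instance its schedule has objective value at most $\alpha$ times the optimum. Let $L_{ik}=\sum_j d_{ijk}$, $L_{jk}=\sum_i d_{ijk}$. Linear program LP-S, variables $C_k$: minimize $\sum_k w_kC_k$ subject to $C_k\ge r_k+L_{ik}$, $C_k\ge r_k+L_{jk}$ for all $k,i,j$;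 $C_k\ge C_{k'}+L_{ik}$, $C_k\ge C_{k'}+L_{jk}$ for all $i,j$, $k'\prec k$; for every input $i$ and $S\subseteq\mathcal{K}$: $\sum_{k\in S}L_{ik}C_k\ge\frac12\big(\sum_{k\in S}L_{ik}^2+(\sum_{k\in S}L_{ik})^2\big)$, and the same for every output $j$ with $L_{jk}$. Algorithm single-network-core-list-scheduling: compute an optimal solution $\bar C$ of LP-S; each flow $f=(i,j,k)$ gets priority $\bar C_f=\bar C_k$. Wait until the first coflow is released; while some flow is incomplete, go through every ready, released and incomplete flow $f=(i,j,k)$ in non-decreasing order of $\bar C_f$ (ties arbitrary) and schedule $f$ if the link $(i,j)$ is idle (neither input $i$ nor output $j$ is used by an already scheduled flow); transmit the scheduled flows at rate $1$ until some new flow becomes ready, completes or is released, and repeat. *)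

theory Defs
  imports "HOL-Analysis.Analysis"
begin

section \<open>Instances\<close>

record 'k coflow_instance =
  ports :: nat
  coflows :: "'k set"
  demand :: "nat \<Rightarrow> nat \<Rightarrow> 'k \<Rightarrow> nat"
  release :: "'k \<Rightarrow> real"
  weight :: "'k \<Rightarrow> real"
  prec :: "('k \<times> 'k) set"

definition valid_instance :: "'k coflow_instance \<Rightarrow> bool" where
  "valid_instance I \<longleftrightarrow>
     1 \<le> ports I \<and> finite (coflows I) \<and>
     (\<forall>k\<in>coflows I. 0 \<le> release I k \<and> 0 \<le> weight I k) \<and>
     prec I \<subseteq> coflows I \<times> coflows I \<and> acyclic (prec I)"

type_synonym 'k flow = "nat \<times> nat \<times> 'k"

fun input_of :: "'k flow \<Rightarrow> nat" where "input_of (i, j, k) = i"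
fun output_of :: "'k flow \<Rightarrow> nat" where "output_of (i, j, k) = j"
fun coflow_of :: "'k flow \<Rightarrow> 'k" where "coflow_of (i, j, k) = k"
fun flow_size :: "'k coflow_instance \<Rightarrow> 'k flow \<Rightarrow> real" where
  "flow_size I (i, j, k) = real (demand I i j k)"

definition flows :: "'k coflow_instance \<Rightarrow> 'k flow set" where
  "flows I = {(i, j, k). i \<in> {1..ports I} \<and> j \<in> {1..ports I} \<and> k \<in> coflows I \<and> 0 < demand I i j k}"

definition flows_of :: "'k coflow_instance \<Rightarrow> 'k \<Rightarrow> 'k flow set" where
  "flows_of I k = {f \<in> flows I. coflow_of f = k}"

text \<open>Number of coflows on a longest directed path; a path is the list of its vertices.  The empty
  list is included, so the value is 0 for an instance without coflows.\<close>

definition max_path :: "'k coflow_instance \<Rightarrow> nat" where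
  "max_path I = Max {length p | p. set p \<subseteq> coflows I \<and> successively (\<lambda>k' k. (k', k) \<in> prec I) p}"


section \<open>Schedules\<close>

text \<open>A schedule gives the transmission rate of every flow at every time \<open>t \<ge> 0\<close>.\<close>

type_synonym 'k schedule = "'k flow \<Rightarrow> real \<Rightarrow> real"

definition sent :: "'k schedule \<Rightarrow> 'k flow \<Rightarrow> real \<Rightarrow> real" where
  "sent x f t = integral {0..t} (x f)"

definition flow_completion :: "'k coflow_instance \<Rightarrow> 'k schedule \<Rightarrow> 'k flow \<Rightarrow> real" where
  "flow_completion I x f = Inf {t. 0 \<le> t \<and> sent x f t = flow_size I f}"

text \<open>A coflow completes with its last flow.  A coflow whose demand matrix is zero has no last flow;
  it completes as soon as it and all its predecessors are released and all its predecessors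
  are completed, which by transitivity involves all its ancestors in the precedence graph.\<close>

definition completion :: "'k coflow_instance \<Rightarrow> 'k schedule \<Rightarrow> 'k \<Rightarrow> real" where
  "completion I x k =
     (if flows_of I k \<noteq> {} then Max (flow_completion I x ` flows_of I k)
      else Max (release I ` {k'. (k', k) \<in> (prec I)\<^sup>*} \<union>
                flow_completion I x ` {f \<in> flows I. (coflow_of f, k) \<in> (prec I)\<^sup>*}))"

definition feasible_schedule :: "'k coflow_instance \<Rightarrow> 'k schedule \<Rightarrow> bool" where
  "feasible_schedule I x \<longleftrightarrow>
     (\<forall>f\<in>flows I. \<forall>t\<ge>0. 0 \<le> x f t \<and> x f integrable_on {0..t} \<and> sent x f t \<le> flow_size I f) \<and>
     (\<forall>f\<in>flows I. \<exists>t\<ge>0. sent x f t = flow_size I f) \<and>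
     (\<forall>i\<in>{1..ports I}. \<forall>t\<ge>0. (\<Sum>f | f \<in> flows I \<and> input_of f = i. x f t) \<le> 1) \<and>
     (\<forall>j\<in>{1..ports I}. \<forall>t\<ge>0. (\<Sum>f | f \<in> flows I \<and> output_of f = j. x f t) \<le> 1) \<and>
     (\<forall>f\<in>flows I. \<forall>t\<ge>0. t < release I (coflow_of f) \<longrightarrow> x f t = 0) \<and>
     (\<forall>f\<in>flows I. \<forall>k'. (k', coflow_of f) \<in> prec I \<longrightarrow>
        (\<forall>t\<ge>0. t < completion I x k' \<longrightarrow> x f t = 0))"

definition total_weighted_completion :: "'k coflow_instance \<Rightarrow> 'k schedule \<Rightarrow> real" where
  "total_weighted_completion I x = (\<Sum>k\<in>coflows I. weight I k * completion I x k)"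

definition optimal_value :: "'k coflow_instance \<Rightarrow> real" where
  "optimal_value I = Inf (total_weighted_completion I ` {x. feasible_schedule I x})"

text \<open>An algorithm that leaves choices open is the set of the schedules it may return; the bound has
  to hold for all of them.\<close>

definition approximation_ratio_at_most ::
  "('k coflow_instance \<Rightarrow> 'k schedule set) \<Rightarrow> ('k coflow_instance \<Rightarrow> real) \<Rightarrow> bool" where
  "approximation_ratio_at_most alg \<alpha> \<longleftrightarrow>
     (\<forall>I. valid_instance I \<longrightarrow>
        alg I \<noteq> {} \<and>
        (\<forall>x\<in>alg I. feasible_schedule I x \<and>
           total_weighted_completion I x \<le> \<alpha> I * optimal_value I))"


section \<open>The linear program\<close>

definition input_load :: "'k coflow_instance \<Rightarrow> nat \<Rightarrow> 'k \<Rightarrow> real" where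
  "input_load I i k = (\<Sum>j\<in>{1..ports I}. real (demand I i j k))"

definition output_load :: "'k coflow_instance \<Rightarrow> nat \<Rightarrow> 'k \<Rightarrow> real" where
  "output_load I j k = (\<Sum>i\<in>{1..ports I}. real (demand I i j k))"

definition LP_S_feasible :: "'k coflow_instance \<Rightarrow> ('k \<Rightarrow> real) \<Rightarrow> bool" where
  "LP_S_feasible I C \<longleftrightarrow>
     (\<forall>k\<in>coflows I. \<forall>i\<in>{1..ports I}. \<forall>j\<in>{1..ports I}.
        C k \<ge> release I k + input_load I i k \<and> C k \<ge> release I k + output_load I j k) \<and>
     (\<forall>(k', k)\<in>prec I. \<forall>i\<in>{1..ports I}. \<forall>j\<in>{1..ports I}.
        C k \<ge> C k' + input_load I i k \<and> C k \<ge> C k' + output_load I j k) \<and>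
     (\<forall>i\<in>{1..ports I}. \<forall>S. S \<subseteq> coflows I \<longrightarrow>
        (\<Sum>k\<in>S. input_load I i k * C k) \<ge>
        1 / 2 * ((\<Sum>k\<in>S. (input_load I i k)\<^sup>2) + (\<Sum>k\<in>S. input_load I i k)\<^sup>2)) \<and>
     (\<forall>j\<in>{1..ports I}. \<forall>S. S \<subseteq> coflows I \<longrightarrow>
        (\<Sum>k\<in>S. output_load I j k * C k) \<ge>
        1 / 2 * ((\<Sum>k\<in>S. (output_load I j k)\<^sup>2) + (\<Sum>k\<in>S. output_load I j k)\<^sup>2))"

definition LP_S_optimal :: "'k coflow_instance \<Rightarrow> ('k \<Rightarrow> real) \<Rightarrow> bool" where
  "LP_S_optimal I C \<longleftrightarrow>
     LP_S_feasible I C \<and>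
     (\<forall>C'. LP_S_feasible I C' \<longrightarrow>
        (\<Sum>k\<in>coflows I. weight I k * C k) \<le> (\<Sum>k\<in>coflows I. weight I k * C' k))"


section \<open>List scheduling\<close>

text \<open>A state of the algorithm consists of the current time and the remaining size of every flow.\<close>

type_synonym 'k state = "real \<times> ('k flow \<Rightarrow> real)"

definition coflow_completed :: "'k coflow_instance \<Rightarrow> 'k state \<Rightarrow> 'k \<Rightarrow> bool" where
  "coflow_completed I s k \<longleftrightarrow>
     (if flows_of I k \<noteq> {} then \<forall>f\<in>flows_of I k. snd s f = 0
      else \<forall>k'. (k', k) \<in> (prec I)\<^sup>* \<longrightarrow>
             release I k' \<le> fst s \<and> (\<forall>f\<in>flows_of I k'. snd s f = 0))"

definition available :: "'k coflow_instance \<Rightarrow> 'k state \<Rightarrow> 'k flow \<Rightarrow> bool" where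
  "available I s f \<longleftrightarrow>
     (\<forall>k'. (k', coflow_of f) \<in> prec I \<longrightarrow> coflow_completed I s k') \<and>
     release I (coflow_of f) \<le> fst s \<and> 0 < snd s f"

definition priority_list :: "'k coflow_instance \<Rightarrow> ('k \<Rightarrow> real) \<Rightarrow> 'k flow list \<Rightarrow> bool" where
  "priority_list I C fs \<longleftrightarrow>
     distinct fs \<and> set fs = flows I \<and> sorted (map (\<lambda>f. C (coflow_of f)) fs)"

definition add_if_idle :: "'k flow \<Rightarrow> 'k flow set \<Rightarrow> 'k flow set" where
  "add_if_idle f A =
     (if \<forall>g\<in>A. input_of g \<noteq> input_of f \<and> output_of g \<noteq> output_of f then insert f A else A)"

definition selected :: "'k coflow_instance \<Rightarrow> 'k flow list \<Rightarrow> 'k state \<Rightarrow> 'k flow set" where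
  "selected I fs s = fold add_if_idle (filter (available I s) fs) {}"

text \<open>A flow becomes ready only when some flow completes or when a coflow with zero demand is released,
  so the next event is a completion of a selected flow or a release of a coflow.\<close>

definition next_event :: "'k coflow_instance \<Rightarrow> 'k flow set \<Rightarrow> 'k state \<Rightarrow> real" where
  "next_event I A s =
     Min ((\<lambda>f. fst s + snd s f) ` A \<union> {t \<in> release I ` coflows I. fst s < t})"

definition scheduling_round :: "'k coflow_instance \<Rightarrow> 'k flow list \<Rightarrow> 'k state \<Rightarrow> 'k state" where
  "scheduling_round I fs s =
     (if \<forall>f\<in>flows I. snd s f = 0 then s
      else let A = selected I fs s; t = next_event I A s
           in (t, \<lambda>f. if f \<in> A then snd s f - (t - fst s) else snd s f))"

text \<open>\<open>ord n\<close> is the order in which the flows are examined in round \<open>n\<close>; the ties may be broken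
  differently in each round.\<close>

primrec state_at :: "'k coflow_instance \<Rightarrow> (nat \<Rightarrow> 'k flow list) \<Rightarrow> nat \<Rightarrow> 'k state" where
  "state_at I ord 0 = (Min (release I ` coflows I), flow_size I)"
| "state_at I ord (Suc n) = scheduling_round I (ord n) (state_at I ord n)"

definition list_schedule :: "'k coflow_instance \<Rightarrow> (nat \<Rightarrow> 'k flow list) \<Rightarrow> 'k schedule" where
  "list_schedule I ord f t =
     (if \<exists>n. fst (state_at I ord n) \<le> t \<and> t < fst (state_at I ord (Suc n)) \<and>
             f \<in> selected I (ord n) (state_at I ord n)
      then 1 else 0)"

definition single_network_core_list_scheduling :: "'k coflow_instance \<Rightarrow> 'k schedule set" where
  "single_network_core_list_scheduling I =
     {list_schedule I ord | C ord. LP_S_optimal I C \<and> (\<forall>n. priority_list I C (ord n))}"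

end

theory Submission
  imports Defs
begin

text \<open>The completion times of any feasible schedule satisfy LP-S, so the LP optimum \<open>C\<close> bounds the optimal
  value from below.  By the set constraints, the coflows \<open>l\<close> with \<open>C l \<le> C k\<close> load every port by at most
  \<open>2 * C k\<close>.  Once all ancestors of \<open>k\<close> are released and completed, an unfinished flow of \<open>k\<close> that is
  not transmitted is blocked at one of its two ports by a flow of such a coflow, so it is finished after
  at most \<open>4 * C k\<close> more time units.  Induction on the depth \<open>d\<close> of \<open>k\<close> in the precedence
  graph gives the completion time bound \<open>(1 + 4 * d) * C k \<le> 5 * d * C k\<close>.\<close>

text \<open>The summand 1 in \<open>1 + 4 * d\<close> pays for all releases at once: every ancestor
  \<open>l\<close> of \<open>k\<close> satisfies \<open>release I l \<le> C l \<le> C k\<close>, so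
  waiting for releases is not charged again at each depth. The same monotonicity of \<open>C\<close>
  along edges turns the bound of an ancestor into a multiple of \<open>C k\<close>. Urgent data is
  counted from the start of the run and not from the moment when the ancestors are done. The count
  is bounded by the urgent load in any case, and nothing need be known about what is left at that
  moment. Coflows with zero demand shape the induction: such a coflow counts as completed only when
  all its ancestors are released and completed, so readiness has to be derived from all ancestors
  and not from the immediate predecessors. The ratio also asserts that the algorithm returns some
  schedule, and the optimal value is an infimum. Hence the LP minimum must be shown to be attained,
  and the rounds must be shown to terminate in a feasible schedule.\<close>

definition sides :: "('k flow \<Rightarrow> nat) set" where
  "sides = {input_of, output_of}"

text \<open>The side \<open>q\<close> is a parameter so that each argument is made once for inputs
  and outputs. Summing over flows instead of demand entries changes nothing, since absent flows have
  demand zero.\<close>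

definition load :: "'k coflow_instance \<Rightarrow> ('k flow \<Rightarrow> nat) \<Rightarrow> nat \<Rightarrow> 'k \<Rightarrow> real" where
  "load I q p k = (\<Sum>f | f \<in> flows I \<and> q f = p \<and> coflow_of f = k. flow_size I f)"

definition dag_path :: "'k coflow_instance \<Rightarrow> 'k list \<Rightarrow> bool" where
  "dag_path I p \<longleftrightarrow> set p \<subseteq> coflows I \<and> successively (\<lambda>k' k. (k', k) \<in> prec I) p"

definition depth :: "'k coflow_instance \<Rightarrow> 'k \<Rightarrow> nat" where
  "depth I k = Max {length p | p. dag_path I p \<and> p \<noteq> [] \<and> last p = k}"

text \<open>Passing to the transitive closure relates any two positions of the path, not only
  neighbours, so a repeated vertex would be a cycle.\<close>

lemma acyclic_path_distinct:
  assumes "acyclic r" "successively (\<lambda>x y. (x, y) \<in> r) p"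
  shows "distinct p"
proof -
  have "successively (\<lambda>x y. (x, y) \<in> r\<^sup>+) p"
    using assms(2) by (rule successively_mono) auto
  then have "sorted_wrt (\<lambda>x y. (x, y) \<in> r\<^sup>+) p"
    by (subst (asm) successively_conv_sorted_wrt) (auto intro: transpI)
  then show ?thesis
    using assms(1) by (induction p) (auto simp: acyclic_def)
qed

lemma sum_Collect_conj_eq:
  fixes h :: "'a \<Rightarrow> 'b::comm_monoid_add"
  assumes "finite A" "\<And>x. x \<in> A \<Longrightarrow> g x \<in> B" "finite B"
  shows "(\<Sum>b\<in>B. \<Sum>x | x \<in> A \<and> g x = b. h x) = (\<Sum>x\<in>A. h x)"
  using sum.group[of A B g h] assms by (simp add: image_subset_iff)

text \<open>Each pair of distinct indices is counted in at least one of the two orders.\<close>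

lemma half_square_le_sum_by_order:
  fixes L C :: "'a \<Rightarrow> real"
  assumes "finite S" and L: "\<And>k. k \<in> S \<Longrightarrow> 0 \<le> L k"
    and C: "\<And>k. k \<in> S \<Longrightarrow> (\<Sum>l | l \<in> S \<and> C l \<le> C k. L l) \<le> C k"
  shows "1 / 2 * ((\<Sum>k\<in>S. (L k)\<^sup>2) + (\<Sum>k\<in>S. L k)\<^sup>2) \<le> (\<Sum>k\<in>S. L k * C k)"
proof -
  define e where "e k l = (if C l \<le> C k then L k * L l else 0)" for k l
  have "(\<Sum>k\<in>S. (L k)\<^sup>2) + (\<Sum>k\<in>S. L k)\<^sup>2 = (\<Sum>k\<in>S. \<Sum>l\<in>S. (if k = l then L k * L l else 0) + L k * L l)"
    using \<open>finite S\<close> by (simp add: sum.distrib sum_product power2_eq_square)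
  also have "\<dots> \<le> (\<Sum>k\<in>S. \<Sum>l\<in>S. e k l + e l k)"
    using L by (intro sum_mono) (auto simp: e_def)
  also have "\<dots> = 2 * (\<Sum>k\<in>S. \<Sum>l\<in>S. e k l)"
    using sum.swap[of e S S] by (simp add: sum.distrib)
  also have "(\<Sum>k\<in>S. \<Sum>l\<in>S. e k l) = (\<Sum>k\<in>S. L k * (\<Sum>l | l \<in> S \<and> C l \<le> C k. L l))"
    using \<open>finite S\<close>
    by (auto simp: e_def sum_distrib_left sum.inter_filter intro!: sum.cong)
  also have "\<dots> \<le> (\<Sum>k\<in>S. L k * C k)"
    using L C by (intro sum_mono mult_left_mono) auto
  finally show ?thesis by simp
qed

section \<open>Port loads, and LP-S with both sides treated alike\<close>

locale coflow =
  fixes I :: "'k coflow_instance"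
  assumes valid: "valid_instance I"
begin

lemma finite_coflows [simp]: "finite (coflows I)"
  and ports_pos: "1 \<le> ports I"
  and release_nonneg: "k \<in> coflows I \<Longrightarrow> 0 \<le> release I k"
  and weight_nonneg: "k \<in> coflows I \<Longrightarrow> 0 \<le> weight I k"
  and acyclic_prec: "acyclic (prec I)"
  and prec_subset: "prec I \<subseteq> coflows I \<times> coflows I"
  using valid unfolding valid_instance_def by auto

lemma prec_coflows: "(k', k) \<in> prec I \<Longrightarrow> k' \<in> coflows I" "(k', k) \<in> prec I \<Longrightarrow> k \<in> coflows I"
  using prec_subset by auto

lemma ancestor_coflows: "(k', k) \<in> (prec I)\<^sup>* \<Longrightarrow> k \<in> coflows I \<Longrightarrow> k' \<in> coflows I"
  by (induction rule: converse_rtrancl_induct) (auto dest: prec_coflows)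

lemma finite_ancestors: "k \<in> coflows I \<Longrightarrow> finite {k'. (k', k) \<in> (prec I)\<^sup>*}"
  by (rule finite_subset[OF _ finite_coflows]) (auto dest: ancestor_coflows)

lemma finite_prec: "finite (prec I)"
  using prec_subset finite_coflows by (meson finite_SigmaI finite_subset)

lemma finite_flows [simp]: "finite (flows I)"
  by (rule finite_subset[of _ "{1..ports I} \<times> {1..ports I} \<times> coflows I"]) (auto simp: flows_def)

lemma finite_flows_of [simp]: "finite (flows_of I k)"
  by (simp add: flows_of_def)

lemma flow_size_pos: "f \<in> flows I \<Longrightarrow> 0 < flow_size I f"
  by (cases f) (auto simp: flows_def)

lemma coflow_of_in_coflows: "f \<in> flows I \<Longrightarrow> coflow_of f \<in> coflows I"
  by (cases f) (auto simp: flows_def)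

lemma side_in_ports: "f \<in> flows I \<Longrightarrow> q \<in> sides \<Longrightarrow> q f \<in> {1..ports I}"
  by (cases f) (auto simp: flows_def sides_def)

lemma load_nonneg: "0 \<le> load I q p k"
  unfolding load_def by (intro sum_nonneg) (simp add: flow_size_pos less_imp_le)

lemma load_eq_0: "flows_of I k = {} \<Longrightarrow> load I q p k = 0"
  unfolding load_def flows_of_def by (intro sum.neutral) auto

lemma sum_load:
  assumes "S \<subseteq> coflows I"
  shows "(\<Sum>k\<in>S. load I q p k) = (\<Sum>f | f \<in> flows I \<and> q f = p \<and> coflow_of f \<in> S. flow_size I f)"
proof -
  have "finite S" using assms finite_coflows finite_subset by blast
  have "(\<Sum>k\<in>S. load I q p k) =
      (\<Sum>k\<in>S. \<Sum>f | f \<in> {f \<in> flows I. q f = p \<and> coflow_of f \<in> S} \<and> coflow_of f = k. flow_size I f)"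
    unfolding load_def by (intro sum.cong) auto
  also have "\<dots> = (\<Sum>f\<in>{f \<in> flows I. q f = p \<and> coflow_of f \<in> S}. flow_size I f)"
    using \<open>finite S\<close> by (intro sum_Collect_conj_eq) auto
  finally show ?thesis .
qed

lemma input_load_eq:
  assumes "i \<in> {1..ports I}" "k \<in> coflows I"
  shows "input_load I i k = load I input_of i k"
proof -
  have "load I input_of i k =
      (\<Sum>f\<in>(\<lambda>j. (i, j, k)) ` {j\<in>{1..ports I}. 0 < demand I i j k}. flow_size I f)"
    unfolding load_def using assms by (intro sum.cong) (auto simp: flows_def image_iff)
  also have "\<dots> = (\<Sum>j\<in>{j\<in>{1..ports I}. 0 < demand I i j k}. real (demand I i j k))"
    by (subst sum.reindex) (auto simp: inj_on_def)
  also have "\<dots> = input_load I i k"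
    unfolding input_load_def by (intro sum.mono_neutral_left) auto
  finally show ?thesis by simp
qed

lemma output_load_eq:
  assumes "j \<in> {1..ports I}" "k \<in> coflows I"
  shows "output_load I j k = load I output_of j k"
proof -
  have "load I output_of j k =
      (\<Sum>f\<in>(\<lambda>i. (i, j, k)) ` {i\<in>{1..ports I}. 0 < demand I i j k}. flow_size I f)"
    unfolding load_def using assms by (intro sum.cong) (auto simp: flows_def image_iff)
  also have "\<dots> = (\<Sum>i\<in>{i\<in>{1..ports I}. 0 < demand I i j k}. real (demand I i j k))"
    by (subst sum.reindex) (auto simp: inj_on_def)
  also have "\<dots> = output_load I j k"
    unfolding output_load_def by (intro sum.mono_neutral_left) auto
  finally show ?thesis by simp
qed

lemma LP_S_feasible_iff:
  "LP_S_feasible I C \<longleftrightarrow> (\<forall>q\<in>sides. \<forall>p\<in>{1..ports I}.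
     (\<forall>k\<in>coflows I. release I k + load I q p k \<le> C k) \<and>
     (\<forall>(k', k)\<in>prec I. C k' + load I q p k \<le> C k) \<and>
     (\<forall>S. S \<subseteq> coflows I \<longrightarrow>
        1 / 2 * ((\<Sum>k\<in>S. (load I q p k)\<^sup>2) + (\<Sum>k\<in>S. load I q p k)\<^sup>2) \<le> (\<Sum>k\<in>S. load I q p k * C k)))"
    (is "?L \<longleftrightarrow> ?R")
proof -
  \<comment> \<open>The parameter \<open>h\<close> lets one congruence serve the sums of loads, of
    squared loads and of loads times \<open>C\<close>.\<close>
  have S: "(\<Sum>k\<in>S. h (input_load I i k) k) = (\<Sum>k\<in>S. h (load I input_of i k) k)"
     "(\<Sum>k\<in>S. h (output_load I i k) k) = (\<Sum>k\<in>S. h (load I output_of i k) k)"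
    if "i \<in> {1..ports I}" "S \<subseteq> coflows I" for i S and h :: "real \<Rightarrow> 'k \<Rightarrow> real"
    using that by (auto simp: input_load_eq output_load_eq subset_iff intro!: sum.cong)
  have side: "(\<forall>i\<in>{1..ports I}. \<forall>j\<in>{1..ports I}. P (input_load I i k) \<and> P (output_load I j k)) \<longleftrightarrow>
     (\<forall>q\<in>sides. \<forall>p\<in>{1..ports I}. P (load I q p k))"
    if "k \<in> coflows I" for P :: "real \<Rightarrow> bool" and k
  proof -
    \<comment> \<open>Input and output constraints share a double quantifier; this port instantiates
      the quantifier of the respective other side.\<close>
    have "1 \<in> {1..ports I}" using ports_pos by simp
    then show ?thesis
      using that unfolding sides_def ball_simps by (auto simp: input_load_eq output_load_eq)
  qed
  have 1: "(\<forall>k\<in>coflows I. \<forall>i\<in>{1..ports I}. \<forall>j\<in>{1..ports I}.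
        C k \<ge> release I k + input_load I i k \<and> C k \<ge> release I k + output_load I j k) \<longleftrightarrow>
     (\<forall>k\<in>coflows I. \<forall>q\<in>sides. \<forall>p\<in>{1..ports I}. release I k + load I q p k \<le> C k)"
    by (intro ball_cong refl side)
  have 2: "(\<forall>(k', k)\<in>prec I. \<forall>i\<in>{1..ports I}. \<forall>j\<in>{1..ports I}.
        C k \<ge> C k' + input_load I i k \<and> C k \<ge> C k' + output_load I j k) \<longleftrightarrow>
     (\<forall>(k', k)\<in>prec I. \<forall>q\<in>sides. \<forall>p\<in>{1..ports I}. C k' + load I q p k \<le> C k)"
    by (intro ball_cong refl) (auto simp only: split: prod.splits intro!: side dest: prec_coflows)
  have 3: "(\<forall>i\<in>{1..ports I}. \<forall>S. S \<subseteq> coflows I \<longrightarrow>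
        (\<Sum>k\<in>S. input_load I i k * C k) \<ge>
        1 / 2 * ((\<Sum>k\<in>S. (input_load I i k)\<^sup>2) + (\<Sum>k\<in>S. input_load I i k)\<^sup>2)) \<and>
     (\<forall>j\<in>{1..ports I}. \<forall>S. S \<subseteq> coflows I \<longrightarrow>
        (\<Sum>k\<in>S. output_load I j k * C k) \<ge>
        1 / 2 * ((\<Sum>k\<in>S. (output_load I j k)\<^sup>2) + (\<Sum>k\<in>S. output_load I j k)\<^sup>2)) \<longleftrightarrow>
     (\<forall>q\<in>sides. \<forall>p\<in>{1..ports I}. \<forall>S. S \<subseteq> coflows I \<longrightarrow>
        1 / 2 * ((\<Sum>k\<in>S. (load I q p k)\<^sup>2) + (\<Sum>k\<in>S. load I q p k)\<^sup>2) \<le> (\<Sum>k\<in>S. load I q p k * C k))"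
    using S(1)[of _ _ "\<lambda>x _. x"] S(1)[of _ _ "\<lambda>x _. x\<^sup>2"] S(1)[of _ _ "\<lambda>x k. x * C k"]
      S(2)[of _ _ "\<lambda>x _. x"] S(2)[of _ _ "\<lambda>x _. x\<^sup>2"] S(2)[of _ _ "\<lambda>x k. x * C k"]
    by (simp add: sides_def)
  show ?thesis
    unfolding LP_S_feasible_def 1 2 3 by (simp only: case_prod_unfold) blast
qed

lemma LP_S_feasibleD:
  assumes "LP_S_feasible I C" "q \<in> sides" "p \<in> {1..ports I}"
  shows "k \<in> coflows I \<Longrightarrow> release I k + load I q p k \<le> C k"
    and "(k', k) \<in> prec I \<Longrightarrow> C k' + load I q p k \<le> C k"
    and "S \<subseteq> coflows I \<Longrightarrow>
      1 / 2 * ((\<Sum>k\<in>S. (load I q p k)\<^sup>2) + (\<Sum>k\<in>S. load I q p k)\<^sup>2) \<le> (\<Sum>k\<in>S. load I q p k * C k)"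
  using assms unfolding LP_S_feasible_iff by blast+

lemma LP_S_release_le:
  assumes "LP_S_feasible I C" "k \<in> coflows I"
  shows "release I k \<le> C k"
  using LP_S_feasibleD(1)[OF assms(1), of input_of 1 k] load_nonneg[of input_of 1 k] ports_pos assms
  by (auto simp: sides_def)

lemma LP_S_prec_le:
  assumes "LP_S_feasible I C" "(k', k) \<in> prec I"
  shows "C k' \<le> C k"
  using LP_S_feasibleD(2)[OF assms(1), of input_of 1 k' k] load_nonneg[of input_of 1 k] ports_pos assms
  by (auto simp: sides_def)

lemma LP_S_ancestor_le:
  assumes "LP_S_feasible I C" "(k', k) \<in> (prec I)\<^sup>*"
  shows "C k' \<le> C k"
  using assms(2) by induction (use LP_S_prec_le[OF assms(1)] in force)+

lemma LP_S_nonneg: "LP_S_feasible I C \<Longrightarrow> k \<in> coflows I \<Longrightarrow> 0 \<le> C k"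
  using LP_S_release_le release_nonneg by fastforce

section \<open>Depth in the precedence graph\<close>

lemma finite_dag_paths: "finite {p. dag_path I p}"
  by (rule finite_subset[OF _ finite_subset_distinct[OF finite_coflows]])
    (auto simp: dag_path_def intro: acyclic_path_distinct[OF acyclic_prec])

lemma finite_dag_path_lengths: "finite {length p | p. dag_path I p \<and> P p}"
  by (rule finite_subset[of _ "length ` {p. dag_path I p}"]) (auto simp: finite_dag_paths)

lemma length_le_max_path: "dag_path I p \<Longrightarrow> length p \<le> max_path I"
  unfolding max_path_def dag_path_def[symmetric]
  using finite_dag_path_lengths[of "\<lambda>_. True"] by (intro Max_ge) auto

lemma length_le_depth: "dag_path I p \<Longrightarrow> p \<noteq> [] \<Longrightarrow> last p = k \<Longrightarrow> length p \<le> depth I k"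
  unfolding depth_def using finite_dag_path_lengths by (intro Max_ge) auto

lemma depth_pos: "k \<in> coflows I \<Longrightarrow> 1 \<le> depth I k"
  using length_le_depth[of "[k]" k] by (simp add: dag_path_def)

lemma depth_attained:
  assumes "k \<in> coflows I"
  obtains p where "dag_path I p" "p \<noteq> []" "last p = k" "length p = depth I k"
proof -
  have "dag_path I [k]" using assms by (simp add: dag_path_def)
  then have "{length p | p. dag_path I p \<and> p \<noteq> [] \<and> last p = k} \<noteq> {}" by force
  from Max_in[OF finite_dag_path_lengths this] show ?thesis
    unfolding depth_def[symmetric] using that by force
qed

lemma depth_le_max_path: "k \<in> coflows I \<Longrightarrow> depth I k \<le> max_path I"
  using depth_attained length_le_max_path by metis

lemma depth_prec:
  assumes "(k', k) \<in> prec I"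
  shows "depth I k' + 1 \<le> depth I k"
proof -
  obtain p where p: "dag_path I p" "p \<noteq> []" "last p = k'" "length p = depth I k'"
    using depth_attained prec_coflows(1)[OF assms] by metis
  then have "dag_path I (p @ [k])"
    using assms prec_coflows by (auto simp: dag_path_def successively_append_iff)
  then show ?thesis using length_le_depth[of "p @ [k]" k] p by simp
qed

lemma depth_ancestor:
  assumes "(k', k) \<in> (prec I)\<^sup>+"
  shows "depth I k' + 1 \<le> depth I k"
  using assms by induction (use depth_prec in force)+

section \<open>Existence of an LP optimum\<close>

definition total_size :: real where
  "total_size = (\<Sum>f\<in>flows I. flow_size I f)"

text \<open>Feasible by design: the sum of all releases dominates each release, and every edge adds
  at least \<open>total_size\<close>, which dominates each load. It serves both as a feasible point
  and as the level at which solutions are truncated.\<close>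

definition LP_bound :: "'k \<Rightarrow> real" where
  "LP_bound k = (\<Sum>l\<in>coflows I. release I l) + total_size * depth I k"

lemma sum_load_le_total: "S \<subseteq> coflows I \<Longrightarrow> (\<Sum>k\<in>S. load I q p k) \<le> total_size"
  unfolding sum_load total_size_def
  by (intro sum_mono2) (auto simp: flow_size_pos less_imp_le)

lemma load_le_total: "k \<in> coflows I \<Longrightarrow> load I q p k \<le> total_size"
  using sum_load_le_total[of "{k}"] by simp

lemma total_size_nonneg: "0 \<le> total_size"
  unfolding total_size_def by (intro sum_nonneg) (simp add: flow_size_pos less_imp_le)

lemma sum_release_nonneg: "0 \<le> (\<Sum>l\<in>coflows I. release I l)"
  by (intro sum_nonneg) (simp add: release_nonneg)

lemma LP_bound_ge:
  assumes "k \<in> coflows I"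
  shows "total_size \<le> LP_bound k" "release I k + total_size \<le> LP_bound k"
proof -
  have 1: "total_size * 1 \<le> total_size * real (depth I k)"
    using depth_pos[OF assms] total_size_nonneg by (intro mult_left_mono) auto
  have 2: "release I k \<le> (\<Sum>l\<in>coflows I. release I l)"
    using assms by (intro member_le_sum) (auto simp: release_nonneg)
  show "total_size \<le> LP_bound k" "release I k + total_size \<le> LP_bound k"
    using 1 2 sum_release_nonneg by (auto simp: LP_bound_def)
qed

lemma LP_bound_prec:
  assumes "(k', k) \<in> prec I"
  shows "LP_bound k' + total_size \<le> LP_bound k"
proof -
  have "total_size * real (depth I k' + 1) \<le> total_size * real (depth I k)"
    using depth_prec[OF assms] total_size_nonneg by (intro mult_left_mono) auto
  then show ?thesis by (simp add: LP_bound_def algebra_simps)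
qed

text \<open>Values above the total demand cannot violate a set constraint; hence truncating an LP solution at
  such a level keeps it feasible, which makes the search for an optimum compact.\<close>

lemma LP_S_set_constraint_truncate:
  assumes S: "S \<subseteq> coflows I" and T: "T \<subseteq> S"
    and C: "1 / 2 * ((\<Sum>k\<in>T. (load I q p k)\<^sup>2) + (\<Sum>k\<in>T. load I q p k)\<^sup>2) \<le> (\<Sum>k\<in>T. load I q p k * D k)"
    and D: "\<And>k. k \<in> S - T \<Longrightarrow> total_size \<le> D k"
  shows "1 / 2 * ((\<Sum>k\<in>S. (load I q p k)\<^sup>2) + (\<Sum>k\<in>S. load I q p k)\<^sup>2) \<le> (\<Sum>k\<in>S. load I q p k * D k)"
proof -
  let ?L = "load I q p"
  let ?U = "S - T"
  define a where "a = sum ?L T"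
  define b where "b = sum ?L ?U"
  have "finite S" using S finite_coflows finite_subset by blast
  have split: "sum h S = sum h T + sum h ?U" for h :: "'k \<Rightarrow> real"
    using sum.subset_diff[OF T \<open>finite S\<close>, of h] by simp
  have ab: "0 \<le> a" "0 \<le> b" "a + b \<le> total_size"
    using sum_load_le_total[OF S, of q p] split[of ?L]
    by (auto simp: a_def b_def intro!: sum_nonneg load_nonneg)
  \<comment> \<open>Adding \<open>?U\<close> to \<open>T\<close> raises the left side by at most
    half of \<open>b * b + 2 * a * b + b * b\<close>, that is \<open>b * (a + b)\<close>. This is at
    most \<open>b * total_size\<close>, which the terms of \<open>?U\<close> on the right
    provide.\<close>
  have "(\<Sum>k\<in>?U. (?L k)\<^sup>2) \<le> (\<Sum>k\<in>?U. ?L k * b)"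
    unfolding power2_eq_square b_def using \<open>finite S\<close>
    by (intro sum_mono mult_left_mono load_nonneg member_le_sum) auto
  then have sq: "(\<Sum>k\<in>?U. (?L k)\<^sup>2) \<le> b * b" by (simp add: sum_distrib_right[symmetric] b_def)
  have "b * total_size = (\<Sum>k\<in>?U. ?L k * total_size)" by (simp add: sum_distrib_right b_def)
  also have "\<dots> \<le> (\<Sum>k\<in>?U. ?L k * D k)"
    using D by (intro sum_mono mult_left_mono load_nonneg) auto
  finally have 1: "b * total_size \<le> (\<Sum>k\<in>?U. ?L k * D k)" .
  have "b * (a + b) \<le> b * total_size" using ab by (intro mult_left_mono) auto
  then have 2: "b * a + b * b \<le> (\<Sum>k\<in>?U. ?L k * D k)" using 1 by (simp add: algebra_simps)
  show ?thesis
    using C sq 2 unfolding split[of "\<lambda>k. (?L k)\<^sup>2"] split[of ?L] split[of "\<lambda>k. ?L k * D k"]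
      a_def[symmetric] b_def[symmetric]
    by (simp add: power2_eq_square algebra_simps)
qed

lemma LP_S_feasible_bound: "LP_S_feasible I LP_bound"
  unfolding LP_S_feasible_iff
proof (intro ballI conjI allI impI; (clarify)?)
  fix q :: "'k flow \<Rightarrow> nat" and p k assume "k \<in> coflows I"
  then show "release I k + load I q p k \<le> LP_bound k"
    using LP_bound_ge(2) load_le_total by (meson add_left_mono order_trans)
next
  fix q :: "'k flow \<Rightarrow> nat" and p k' k assume *: "(k', k) \<in> prec I"
  show "LP_bound k' + load I q p k \<le> LP_bound k"
    using LP_bound_prec[OF *] load_le_total[of k q p] prec_coflows[OF *] by simp
next
  fix q :: "'k flow \<Rightarrow> nat" and p S assume "S \<subseteq> coflows I"
  then show "1 / 2 * ((\<Sum>k\<in>S. (load I q p k)\<^sup>2) + (\<Sum>k\<in>S. load I q p k)\<^sup>2) \<le>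
      (\<Sum>k\<in>S. load I q p k * LP_bound k)"
    by (rule LP_S_set_constraint_truncate[where T = "{}"]) (use \<open>S \<subseteq> coflows I\<close> LP_bound_ge(1) in auto)
qed

text \<open>Release and precedence constraints survive pointwise minima of feasible points. Set
  constraints do not in general; here they do because the truncated coordinates are still at least
  \<open>total_size\<close>.\<close>

lemma LP_S_feasible_min_bound:
  assumes C: "LP_S_feasible I C"
  shows "LP_S_feasible I (\<lambda>k. min (C k) (LP_bound k))"
  unfolding LP_S_feasible_iff
proof (intro ballI conjI allI impI; (clarify)?)
  fix q :: "'k flow \<Rightarrow> nat" and p k assume "q \<in> sides" "p \<in> {1..ports I}" "k \<in> coflows I"
  then show "release I k + load I q p k \<le> min (C k) (LP_bound k)"
    using LP_S_feasibleD(1) C LP_S_feasible_bound by simp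
next
  fix q :: "'k flow \<Rightarrow> nat" and p k' k assume "q \<in> sides" "p \<in> {1..ports I}" "(k', k) \<in> prec I"
  then show "min (C k') (LP_bound k') + load I q p k \<le> min (C k) (LP_bound k)"
    using LP_S_feasibleD(2)[OF C, of q p k' k] LP_S_feasibleD(2)[OF LP_S_feasible_bound, of q p k' k]
    by (auto simp: min_def)
next
  fix q :: "'k flow \<Rightarrow> nat" and p S assume qp: "q \<in> sides" "p \<in> {1..ports I}" and S: "S \<subseteq> coflows I"
  let ?T = "{k \<in> S. C k \<le> LP_bound k}"
  have "(\<Sum>k\<in>?T. load I q p k * C k) = (\<Sum>k\<in>?T. load I q p k * min (C k) (LP_bound k))"
    by (intro sum.cong) auto
  then show "1 / 2 * ((\<Sum>k\<in>S. (load I q p k)\<^sup>2) + (\<Sum>k\<in>S. load I q p k)\<^sup>2) \<le>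
      (\<Sum>k\<in>S. load I q p k * min (C k) (LP_bound k))"
    using LP_S_feasibleD(3)[OF C qp, of ?T] S LP_bound_ge(1)
    by (intro LP_S_set_constraint_truncate[OF S, of ?T]) (auto simp: min_def)
qed

lemma LP_S_feasible_cong:
  assumes C: "LP_S_feasible I C" and eq: "\<And>k. k \<in> coflows I \<Longrightarrow> D k = C k"
  shows "LP_S_feasible I D"
  unfolding LP_S_feasible_iff
proof (intro ballI conjI allI impI; (clarify)?)
  fix q :: "'k flow \<Rightarrow> nat" and p k assume "q \<in> sides" "p \<in> {1..ports I}" "k \<in> coflows I"
  then show "release I k + load I q p k \<le> D k"
    using LP_S_feasibleD(1)[OF C] eq by simp
next
  fix q :: "'k flow \<Rightarrow> nat" and p k' k assume "q \<in> sides" "p \<in> {1..ports I}" "(k', k) \<in> prec I"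
  then show "D k' + load I q p k \<le> D k"
    using LP_S_feasibleD(2)[OF C] eq prec_coflows by simp
next
  fix q :: "'k flow \<Rightarrow> nat" and p S assume qp: "q \<in> sides" "p \<in> {1..ports I}" and S: "S \<subseteq> coflows I"
  have "(\<Sum>k\<in>S. load I q p k * C k) = (\<Sum>k\<in>S. load I q p k * D k)"
    using S eq by (intro sum.cong) auto
  then show "1 / 2 * ((\<Sum>k\<in>S. (load I q p k)\<^sup>2) + (\<Sum>k\<in>S. load I q p k)\<^sup>2) \<le> (\<Sum>k\<in>S. load I q p k * D k)"
    using LP_S_feasibleD(3)[OF C qp S] by simp
qed

text \<open>Functions carry the topology of pointwise convergence, and every constraint is a
  non-strict inequality between continuous functions of the coordinates.\<close>

lemma closed_LP_S_feasible: "closed {C. LP_S_feasible I C}"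
proof -
  have "continuous_on UNIV (\<lambda>C::'k \<Rightarrow> real. C k)" for k by simp
  note [continuous_intros] = this
  have case_prod_closed: "closed {C. \<forall>(k', k)\<in>prec I. P C k' k}"
    if "\<And>k' k. closed {C. P C k' k}" for P :: "('k \<Rightarrow> real) \<Rightarrow> 'k \<Rightarrow> 'k \<Rightarrow> bool"
    using that unfolding Ball_def by (auto intro!: closed_Collect_all closed_Collect_imp)
  show ?thesis
    unfolding LP_S_feasible_iff Ball_def[of sides] Ball_def[of "{1..ports I}"] Ball_def[of "coflows I"]
    by (intro closed_Collect_all closed_Collect_imp closed_Collect_conj open_Collect_const
        case_prod_closed closed_Collect_le continuous_intros)
qed

lemma LP_S_optimal_exists: "\<exists>C. LP_S_optimal I C"
proof -
  \<comment> \<open>Coordinates outside the instance are pinned to 0, so the box over the whole type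
    is compact as a product of compact sets.\<close>
  let ?B = "\<lambda>k. if k \<in> coflows I then {0..LP_bound k} else {0::real}"
  let ?X = "(\<Pi>\<^sub>E k\<in>UNIV. ?B k) \<inter> {C. LP_S_feasible I C}"
  let ?obj = "\<lambda>C. \<Sum>k\<in>coflows I. weight I k * C k"
  define trunc where "trunc C k = (if k \<in> coflows I then min (C k) (LP_bound k) else 0)" for C k
  have "compact (\<Pi>\<^sub>E k\<in>UNIV. ?B k)"
    using compactin_PiE[of "\<lambda>_. euclidean" UNIV ?B] by (auto simp: euclidean_product_topology)
  then have "compact ?X" using closed_LP_S_feasible by (rule compact_Int_closed)
  have trunc: "trunc C \<in> ?X" if "LP_S_feasible I C" for C
  proof -
    have "LP_S_feasible I (trunc C)"
      using LP_S_feasible_min_bound[OF that] by (rule LP_S_feasible_cong) (simp add: trunc_def)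
    then show ?thesis using LP_S_nonneg[OF that] LP_S_nonneg[OF LP_S_feasible_bound]
      by (auto simp: trunc_def)
  qed
  have "continuous_on ?X ?obj"
    by (intro continuous_intros continuous_on_subset[OF continuous_on_product_coordinates]) auto
  moreover have "?X \<noteq> {}" using trunc[OF LP_S_feasible_bound] by blast
  ultimately obtain C where C: "C \<in> ?X" "\<forall>D\<in>?X. ?obj C \<le> ?obj D"
    using continuous_attains_inf[of ?X ?obj] \<open>compact ?X\<close> by blast
  have "?obj C \<le> ?obj D" if "LP_S_feasible I D" for D
  proof -
    \<comment> \<open>Weights are nonnegative, so truncation never raises the objective and the
      minimum over the box is global.\<close>
    have "?obj (trunc D) \<le> ?obj D"
      using weight_nonneg by (intro sum_mono mult_left_mono) (auto simp: trunc_def)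
    then show ?thesis using bspec[OF C(2) trunc[OF that]] by linarith
  qed
  then show ?thesis using C by (auto simp: LP_S_optimal_def)
qed

section \<open>Feasible schedules satisfy the LP\<close>

lemma flow_in_flows_of: "f \<in> flows I \<Longrightarrow> f \<in> flows_of I (coflow_of f)"
  by (simp add: flows_of_def)

lemma flow_completion_le_completion:
  assumes "f \<in> flows_of I k" shows "flow_completion I x f \<le> completion I x k"
  using assms unfolding completion_def by (auto intro!: Max_ge)

text \<open>Treats both cases of \<open>completion\<close> together: ancestors include
  \<open>k\<close> itself, so its own flows are covered, and releases matter only when it has
  none.\<close>

lemma completion_leI:
  assumes "k \<in> coflows I"
    and "\<And>f. f \<in> flows I \<Longrightarrow> (coflow_of f, k) \<in> (prec I)\<^sup>* \<Longrightarrow> flow_completion I x f \<le> b"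
    and "flows_of I k = {} \<Longrightarrow> (\<And>k'. (k', k) \<in> (prec I)\<^sup>* \<Longrightarrow> release I k' \<le> b)"
  shows "completion I x k \<le> b"
proof (cases "flows_of I k = {}")
  case True
  have "release I k \<in> release I ` {k'. (k', k) \<in> (prec I)\<^sup>*}" by auto
  then show ?thesis unfolding completion_def using True assms finite_ancestors[OF assms(1)]
    by (auto intro!: Max.boundedI)
next
  case False
  then show ?thesis unfolding completion_def using assms(2)
    by (auto intro!: Max.boundedI simp: flows_of_def)
qed

lemma completion_no_flows_ge:
  assumes "k \<in> coflows I" "flows_of I k = {}" "(k', k) \<in> (prec I)\<^sup>*"
  shows "release I k' \<le> completion I x k"
    and "f \<in> flows_of I k' \<Longrightarrow> flow_completion I x f \<le> completion I x k"
  using assms finite_ancestors[OF assms(1)]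
  by (auto simp: completion_def flows_of_def intro!: Max_ge)

context
  fixes x :: "'k schedule"
  assumes feas: "feasible_schedule I x"
begin

lemma rate_nonneg: "f \<in> flows I \<Longrightarrow> 0 \<le> t \<Longrightarrow> 0 \<le> x f t"
  and rate_integrable: "f \<in> flows I \<Longrightarrow> 0 \<le> t \<Longrightarrow> x f integrable_on {0..t}"
  and sent_le_size: "f \<in> flows I \<Longrightarrow> 0 \<le> t \<Longrightarrow> sent x f t \<le> flow_size I f"
  and rate_before_release: "f \<in> flows I \<Longrightarrow> 0 \<le> t \<Longrightarrow> t < release I (coflow_of f) \<Longrightarrow> x f t = 0"
  and rate_before_predecessor:
    "f \<in> flows I \<Longrightarrow> (k', coflow_of f) \<in> prec I \<Longrightarrow> 0 \<le> t \<Longrightarrow> t < completion I x k' \<Longrightarrow> x f t = 0"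
  using feas unfolding feasible_schedule_def by auto

lemma all_sent: "f \<in> flows I \<Longrightarrow> \<exists>t\<ge>0. sent x f t = flow_size I f"
  using feas unfolding feasible_schedule_def by blast

lemma side_capacity:
  "q \<in> sides \<Longrightarrow> p \<in> {1..ports I} \<Longrightarrow> 0 \<le> t \<Longrightarrow> (\<Sum>f | f \<in> flows I \<and> q f = p. x f t) \<le> 1"
  using feas unfolding feasible_schedule_def sides_def by auto

lemma rate_integrable_interval: "f \<in> flows I \<Longrightarrow> 0 \<le> s \<Longrightarrow> x f integrable_on {s..t}"
  by (cases "s \<le> t") (auto intro: integrable_on_subinterval[OF rate_integrable[of f t]])

lemma sent_diff:
  assumes "f \<in> flows I" "0 \<le> s" "s \<le> t"
  shows "sent x f t - sent x f s = integral {s..t} (x f)"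
  using Henstock_Kurzweil_Integration.integral_combine[OF assms(2,3) rate_integrable[OF assms(1)]] assms(2,3)
  unfolding sent_def by simp

lemma sent_mono:
  assumes "f \<in> flows I" "0 \<le> s" "s \<le> t"
  shows "sent x f s \<le> sent x f t"
proof -
  have "0 \<le> integral {s..t} (x f)"
    using assms rate_nonneg rate_integrable_interval by (intro integral_nonneg) auto
  then show ?thesis using sent_diff[OF assms] by simp
qed

text \<open>The amount sent is continuous in time, so the times at which it equals the flow size
  form a compact set up to any horizon, and the infimum is a minimum.\<close>

lemma flow_completion_attained:
  assumes f: "f \<in> flows I"
  shows "0 \<le> flow_completion I x f" "sent x f (flow_completion I x f) = flow_size I f"
proof -
  obtain T where T: "0 \<le> T" "sent x f T = flow_size I f" using all_sent[OF f] by blast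
  let ?A = "{t \<in> {0..T}. sent x f t = flow_size I f}"
  have "continuous_on {0..T} (sent x f)"
    unfolding sent_def using rate_integrable[OF f T(1)] by (rule indefinite_integral_continuous_1)
  then have "closed ?A" using continuous_closed_preimage_constant[OF _ closed_atLeastAtMost] by blast
  moreover have "?A = {0..T} \<inter> ?A" by auto
  ultimately have "compact ?A" by (metis compact_Icc compact_Int_closed)
  moreover have "?A \<noteq> {}" using T by auto
  ultimately obtain s where s: "s \<in> ?A" "\<forall>t\<in>?A. s \<le> t" using compact_attains_inf[of ?A] by blast
  have "flow_completion I x f = s"
    unfolding flow_completion_def
  proof (rule cInf_eq_minimum)
    show "s \<in> {t. 0 \<le> t \<and> sent x f t = flow_size I f}" using s by auto
    fix t assume "t \<in> {t. 0 \<le> t \<and> sent x f t = flow_size I f}"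
    then show "s \<le> t" using s by (cases "t \<le> T") auto
  qed
  then show "0 \<le> flow_completion I x f" "sent x f (flow_completion I x f) = flow_size I f"
    using s by auto
qed

lemma sent_after_completion:
  assumes "f \<in> flows I" "flow_completion I x f \<le> t"
  shows "sent x f t = flow_size I f"
  using sent_mono[OF assms(1) flow_completion_attained(1)[OF assms(1)] assms(2)]
    flow_completion_attained[OF assms(1)] sent_le_size[OF assms(1), of t] assms(2) by simp

lemma sent_eq_0:
  assumes "f \<in> flows I" "0 \<le> a" "\<And>t. 0 \<le> t \<Longrightarrow> t < a \<Longrightarrow> x f t = 0"
  shows "sent x f a = 0"
proof -
  have "(x f has_integral 0) {0..a}"
    by (rule has_integral_spike_finite[of "{a}" _ _ "\<lambda>_. 0"]) (use assms in auto)
  then show ?thesis unfolding sent_def by (rule integral_unique)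
qed

lemma flow_completion_ge:
  assumes "f \<in> flows I" "0 \<le> a" "\<And>t. 0 \<le> t \<Longrightarrow> t < a \<Longrightarrow> x f t = 0"
  shows "a \<le> flow_completion I x f"
proof (rule ccontr)
  assume "\<not> a \<le> flow_completion I x f"
  then have "sent x f a = flow_size I f" using sent_after_completion[OF assms(1)] by simp
  then show False using sent_eq_0[OF assms] flow_size_pos[OF assms(1)] by simp
qed

lemma sent_window_le:
  assumes "q \<in> sides" "p \<in> {1..ports I}" and F: "F \<subseteq> {f \<in> flows I. q f = p}"
    and ab: "0 \<le> a" "a \<le> b"
  shows "(\<Sum>f\<in>F. sent x f b - sent x f a) \<le> b - a"
proof -
  have "finite F" using F by (rule finite_subset) simp
  have "(\<Sum>f\<in>F. sent x f b - sent x f a) = (\<Sum>f\<in>F. integral {a..b} (x f))"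
    using F ab by (intro sum.cong sent_diff) auto
  also have "\<dots> = integral {a..b} (\<lambda>t. \<Sum>f\<in>F. x f t)"
    using F ab \<open>finite F\<close> by (intro integral_sum[symmetric] rate_integrable_interval) auto
  also have "\<dots> \<le> integral {a..b} (\<lambda>_. 1)"
  proof (rule integral_le)
    show "(\<lambda>t. \<Sum>f\<in>F. x f t) integrable_on {a..b}"
      using F ab \<open>finite F\<close> by (intro integrable_sum rate_integrable_interval) auto
    fix t assume "t \<in> {a..b}"
    then have t: "0 \<le> t" using ab by simp
    have "(\<Sum>f\<in>F. x f t) \<le> (\<Sum>f | f \<in> flows I \<and> q f = p. x f t)"
      using F t rate_nonneg by (intro sum_mono2) auto
    then show "(\<Sum>f\<in>F. x f t) \<le> 1" using side_capacity[OF assms(1,2) t] by simp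
  qed (rule integrable_const_ivl)
  also have "\<dots> = b - a" using ab by simp
  finally show ?thesis .
qed

text \<open>All data of \<open>F\<close> crosses one port of unit capacity between \<open>a\<close>
  and \<open>b\<close>. With \<open>a\<close> a release time, the completion of a predecessor, or 0,
  this yields the three kinds of LP constraints.\<close>

lemma window_le:
  assumes qp: "q \<in> sides" "p \<in> {1..ports I}" and F: "F \<subseteq> {f \<in> flows I. q f = p}"
    and ab: "0 \<le> a" "a \<le> b"
    and idle: "\<And>f t. f \<in> F \<Longrightarrow> 0 \<le> t \<Longrightarrow> t < a \<Longrightarrow> x f t = 0"
    and compl: "\<And>f. f \<in> F \<Longrightarrow> flow_completion I x f \<le> b"
  shows "a + (\<Sum>f\<in>F. flow_size I f) \<le> b"
proof -
  have "(\<Sum>f\<in>F. flow_size I f) = (\<Sum>f\<in>F. sent x f b - sent x f a)"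
    using F ab idle compl by (intro sum.cong) (auto simp: sent_after_completion sent_eq_0)
  then show ?thesis using sent_window_le[OF qp F ab] by simp
qed

lemma completion_ge_load:
  assumes qp: "q \<in> sides" "p \<in> {1..ports I}" and ne: "flows_of I k \<noteq> {}" and "0 \<le> a"
    and idle: "\<And>f t. f \<in> flows_of I k \<Longrightarrow> 0 \<le> t \<Longrightarrow> t < a \<Longrightarrow> x f t = 0"
  shows "a + load I q p k \<le> completion I x k"
proof -
  \<comment> \<open>Any flow of \<open>k\<close> shows \<open>a \<le> completion I x k\<close>; the
    coflow may have no flow at the port \<open>p\<close>.\<close>
  obtain f where f: "f \<in> flows_of I k" using ne by blast
  then have "a \<le> flow_completion I x f"
    using \<open>0 \<le> a\<close> idle by (intro flow_completion_ge) (auto simp: flows_of_def)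
  then have "a \<le> completion I x k" using flow_completion_le_completion[OF f, of x] by simp
  then show ?thesis unfolding load_def
    using idle \<open>0 \<le> a\<close> flow_completion_le_completion
    by (intro window_le[OF qp]) (auto simp: flows_of_def)
qed

lemma completion_ge_release:
  assumes qp: "q \<in> sides" "p \<in> {1..ports I}" and k: "k \<in> coflows I"
  shows "release I k + load I q p k \<le> completion I x k"
proof (cases "flows_of I k = {}")
  case True
  then show ?thesis using completion_no_flows_ge(1)[OF k True, of k x] load_eq_0 by simp
next
  case False
  then show ?thesis using release_nonneg[OF k]
    by (intro completion_ge_load[OF qp]) (auto simp: flows_of_def rate_before_release)
qed

lemma completion_nonneg:
  assumes "k \<in> coflows I" shows "0 \<le> completion I x k"
  using completion_ge_release[of input_of 1 k] release_nonneg load_nonneg[of input_of 1 k] assms ports_pos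
  by (fastforce simp: sides_def)

lemma completion_ge_predecessor:
  assumes qp: "q \<in> sides" "p \<in> {1..ports I}" and "(k', k) \<in> prec I"
  shows "completion I x k' + load I q p k \<le> completion I x k"
proof (cases "flows_of I k = {}")
  case True
  \<comment> \<open>A coflow without flows waits for all its ancestors, among them those of
    \<open>k'\<close>. This gives monotonicity even if \<open>k'\<close> has no flow either.\<close>
  have anc: "(l, k) \<in> (prec I)\<^sup>*" if "(l, k') \<in> (prec I)\<^sup>*" for l
    using that assms(3) by (rule rtrancl_into_rtrancl)
  have "completion I x k' \<le> completion I x k"
    using prec_coflows[OF assms(3)] True anc completion_no_flows_ge[OF _ True]
    by (intro completion_leI) (auto simp: flows_of_def)
  then show ?thesis using load_eq_0[OF True] by simp
next
  case False
  then show ?thesis using completion_nonneg prec_coflows[OF assms(3)] assms(3)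
    by (intro completion_ge_load[OF qp]) (auto simp: flows_of_def rate_before_predecessor)
qed

lemma LP_S_feasible_completion: "LP_S_feasible I (completion I x)"
  unfolding LP_S_feasible_iff
proof (intro ballI conjI allI impI; (clarify)?)
  fix q :: "'k flow \<Rightarrow> nat" and p k assume "q \<in> sides" "p \<in> {1..ports I}" "k \<in> coflows I"
  then show "release I k + load I q p k \<le> completion I x k" by (rule completion_ge_release)
next
  fix q :: "'k flow \<Rightarrow> nat" and p k' k assume "q \<in> sides" "p \<in> {1..ports I}" "(k', k) \<in> prec I"
  then show "completion I x k' + load I q p k \<le> completion I x k" by (rule completion_ge_predecessor)
next
  fix q :: "'k flow \<Rightarrow> nat" and p S assume qp: "q \<in> sides" "p \<in> {1..ports I}" and S: "S \<subseteq> coflows I"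
  let ?C = "completion I x"
  \<comment> \<open>Coflows completing no later than \<open>k\<close> send all their data at
    \<open>p\<close> between 0 and \<open>?C k\<close>; this is the premise of the double count over
    ordered pairs.\<close>
  have "(\<Sum>l | l \<in> S \<and> ?C l \<le> ?C k. load I q p l) \<le> ?C k" if k: "k \<in> S" for k
  proof -
    let ?T = "{l \<in> S. ?C l \<le> ?C k}"
    have T: "flow_completion I x f \<le> ?C k" if "f \<in> flows I" "coflow_of f \<in> ?T" for f
      using flow_completion_le_completion[OF flow_in_flows_of[OF that(1)], of x] that(2) by simp
    have "0 \<le> ?C k" using completion_nonneg k S by auto
    then have "0 + (\<Sum>f | f \<in> flows I \<and> q f = p \<and> coflow_of f \<in> ?T. flow_size I f) \<le> ?C k"
      using T by (intro window_le[OF qp]) auto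
    then show ?thesis using S by (subst sum_load) auto
  qed
  then show "1 / 2 * ((\<Sum>k\<in>S. (load I q p k)\<^sup>2) + (\<Sum>k\<in>S. load I q p k)\<^sup>2) \<le>
      (\<Sum>k\<in>S. load I q p k * ?C k)"
    using S finite_subset[OF S finite_coflows]
    by (intro half_square_le_sum_by_order) (auto simp: load_nonneg)
qed

end

text \<open>The schedule \<open>y\<close> only witnesses that the infimum is taken over a nonempty
  set; the list schedule itself will supply it.\<close>

lemma LP_S_optimal_le_optimal_value:
  assumes "LP_S_optimal I C" and "feasible_schedule I y"
  shows "(\<Sum>k\<in>coflows I. weight I k * C k) \<le> optimal_value I"
  unfolding optimal_value_def
proof (rule cInf_greatest)
  show "total_weighted_completion I ` {x. feasible_schedule I x} \<noteq> {}" using assms(2) by blast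
  fix v assume "v \<in> total_weighted_completion I ` {x. feasible_schedule I x}"
  then show "(\<Sum>k\<in>coflows I. weight I k * C k) \<le> v"
    using LP_S_feasible_completion assms(1)
    by (auto simp: LP_S_optimal_def total_weighted_completion_def)
qed

end

section \<open>The rounds of list scheduling\<close>

lemma fold_add_if_idle_mono: "B \<subseteq> fold add_if_idle fs B"
proof (induction fs arbitrary: B)
  case (Cons f fs)
  have "B \<subseteq> add_if_idle f B" by (auto simp: add_if_idle_def)
  with Cons[of "add_if_idle f B"] show ?case by auto
qed simp

lemma fold_add_if_idle_subset: "fold add_if_idle fs B \<subseteq> B \<union> set fs"
proof (induction fs arbitrary: B)
  case (Cons f fs)
  have "add_if_idle f B \<subseteq> insert f B" by (auto simp: add_if_idle_def)
  with Cons[of "add_if_idle f B"] show ?case by auto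
qed simp

lemma fold_add_if_idle_matching:
  assumes "\<forall>f\<in>B. \<forall>g\<in>B. f \<noteq> g \<longrightarrow> input_of f \<noteq> input_of g \<and> output_of f \<noteq> output_of g"
  shows "\<forall>f\<in>fold add_if_idle fs B. \<forall>g\<in>fold add_if_idle fs B.
    f \<noteq> g \<longrightarrow> input_of f \<noteq> input_of g \<and> output_of f \<noteq> output_of g"
  using assms
proof (induction fs arbitrary: B)
  case (Cons f fs)
  have "\<forall>g\<in>add_if_idle f B. \<forall>h\<in>add_if_idle f B.
      g \<noteq> h \<longrightarrow> input_of g \<noteq> input_of h \<and> output_of g \<noteq> output_of h"
  proof (cases "\<forall>g\<in>B. input_of g \<noteq> input_of f \<and> output_of g \<noteq> output_of f")
    case True
    then have "add_if_idle f B = insert f B" by (simp add: add_if_idle_def)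
    with True Cons.prems show ?thesis by (metis insertE)
  next
    case False
    then have "add_if_idle f B = B" by (auto simp: add_if_idle_def)
    with Cons.prems show ?thesis by simp
  qed
  from Cons.IH[OF this] show ?case by simp
qed simp

text \<open>When \<open>f\<close> is examined, it is either inserted and is its own witness, or
  conflicts with a flow already chosen, which came earlier and has no larger key. The accumulator
  \<open>B\<close> is general for the induction.\<close>

lemma fold_add_if_idle_blocked:
  fixes h :: "'k flow \<Rightarrow> real"
  assumes "sorted (map h fs)" "\<forall>g\<in>B. \<forall>f\<in>set fs. h g \<le> h f" "f \<in> set fs"
  shows "\<exists>g\<in>fold add_if_idle fs B. h g \<le> h f \<and> (input_of g = input_of f \<or> output_of g = output_of f)"
  using assms
proof (induction fs arbitrary: B)
  case (Cons a fs)
  let ?B = "add_if_idle a B"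
  show ?case
  proof (cases "f = a")
    case True
    have "\<exists>g\<in>?B. h g \<le> h a \<and> (input_of g = input_of a \<or> output_of g = output_of a)"
      using Cons.prems(2) by (auto simp: add_if_idle_def)
    then show ?thesis using True fold_add_if_idle_mono[of ?B fs] by auto
  next
    case False
    have "\<forall>g\<in>?B. \<forall>f\<in>set fs. h g \<le> h f"
      using Cons.prems by (auto simp: add_if_idle_def)
    then show ?thesis using Cons False by simp
  qed
qed simp

text \<open>Only the set of examined flows is fixed here: termination and feasibility hold for every
  order, and priorities enter with the approximation bound.\<close>

locale list_run = coflow I for I :: "'k coflow_instance" +
  fixes ord :: "nat \<Rightarrow> 'k flow list"
  assumes set_ord: "\<And>n. set (ord n) = flows I"
begin

declare state_at.simps(2) [simp del]

abbreviation state :: "nat \<Rightarrow> 'k state" where "state n \<equiv> state_at I ord n"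
abbreviation time :: "nat \<Rightarrow> real" where "time n \<equiv> fst (state n)"
abbreviation rem :: "nat \<Rightarrow> 'k flow \<Rightarrow> real" where "rem n \<equiv> snd (state n)"
abbreviation active :: "nat \<Rightarrow> 'k flow set" where "active n \<equiv> selected I (ord n) (state n)"
abbreviation finished :: "nat \<Rightarrow> bool" where "finished n \<equiv> \<forall>f\<in>flows I. rem n f = 0"
abbreviation events :: "nat \<Rightarrow> real set" where
  "events n \<equiv> (\<lambda>f. time n + rem n f) ` active n \<union> {t \<in> release I ` coflows I. time n < t}"
abbreviation schedule :: "'k schedule" where "schedule \<equiv> list_schedule I ord"

lemma active_flows: "f \<in> active n \<Longrightarrow> f \<in> flows I"
  and active_available: "f \<in> active n \<Longrightarrow> available I (state n) f"
  using fold_add_if_idle_subset[of "filter (available I (state n)) (ord n)" "{}"] set_ord[of n]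
  by (auto simp: selected_def)

lemma active_matching:
  assumes "f \<in> active n" "g \<in> active n" "q \<in> sides" "q f = q g"
  shows "f = g"
  using fold_add_if_idle_matching[of "{}" "filter (available I (state n)) (ord n)"] assms
  unfolding selected_def sides_def by fastforce

lemma finite_active [simp]: "finite (active n)"
  using active_flows by (intro finite_subset[OF _ finite_flows]) auto

lemma active_rem_pos: "f \<in> active n \<Longrightarrow> 0 < rem n f"
  using active_available by (auto simp: available_def)

text \<open>The key \<open>h\<close> is free: LP values give the charging argument, while a constant
  key gives just that some flow is selected.\<close>

lemma available_blocked:
  fixes h :: "'k flow \<Rightarrow> real"
  assumes "f \<in> flows I" "available I (state n) f" "sorted (map h (ord n))"
  shows "\<exists>g\<in>active n. h g \<le> h f \<and> (\<exists>q\<in>sides. q g = q f)"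
proof -
  have "f \<in> set (filter (available I (state n)) (ord n))" using assms set_ord by simp
  from fold_add_if_idle_blocked[OF sorted_filter[OF assms(3)] _ this, of "{}"]
  show ?thesis by (simp add: selected_def sides_def)
qed

lemma finite_events: "finite (events n)"
  by auto

lemma coflow_completedI:
  assumes "\<And>a. (a, k) \<in> (prec I)\<^sup>* \<Longrightarrow> release I a \<le> time n"
    and "\<And>a g. (a, k) \<in> (prec I)\<^sup>* \<Longrightarrow> g \<in> flows_of I a \<Longrightarrow> rem n g = 0"
  shows "coflow_completed I (state n) k"
  using assms(1) assms(2)[OF rtrancl_refl] assms(2) unfolding coflow_completed_def by presburger

text \<open>If no release lies ahead, a coflow that is minimal in the precedence order among the
  unfinished ones has an available flow, so some flow is selected and its finishing time is an
  event.\<close>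

lemma events_nonempty:
  assumes rem: "\<And>f. f \<in> flows I \<Longrightarrow> 0 \<le> rem n f" and "\<not> finished n"
  shows "events n \<noteq> {}"
proof (cases "\<exists>k\<in>coflows I. time n < release I k")
  case False
  let ?K = "coflow_of ` {f \<in> flows I. rem n f \<noteq> 0}"
  have "wf ((prec I)\<^sup>+)" using finite_acyclic_wf[OF finite_prec acyclic_prec] by (rule wf_trancl)
  moreover obtain k where "k \<in> ?K" using \<open>\<not> finished n\<close> by blast
  ultimately obtain k where k: "k \<in> ?K" "\<And>l. (l, k) \<in> (prec I)\<^sup>+ \<Longrightarrow> l \<notin> ?K"
    by (rule wfE_min) blast
  then obtain f where f: "f \<in> flows I" "rem n f \<noteq> 0" "coflow_of f = k" by blast
  have rel: "release I l \<le> time n" if "l \<in> coflows I" for l using False that by force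
  have "coflow_completed I (state n) k'" if k': "(k', k) \<in> prec I" for k'
  proof (rule coflow_completedI)
    fix a assume a: "(a, k') \<in> (prec I)\<^sup>*"
    show "release I a \<le> time n" using rel[OF ancestor_coflows[OF a]] prec_coflows(1)[OF k'] by simp
    have "(a, k) \<in> (prec I)\<^sup>+" using a k' by (rule rtrancl_into_trancl1)
    then have "a \<notin> ?K" by (rule k(2))
    then show "rem n g = 0" if "g \<in> flows_of I a" for g
      using that unfolding flows_of_def by blast
  qed
  then have "available I (state n) f"
    using f rem[OF f(1)] rel[OF coflow_of_in_coflows[OF f(1)]] by (auto simp: available_def)
  moreover have "sorted (map (\<lambda>_. 0::real) (ord n))" by (simp add: map_replicate_const)
  ultimately show ?thesis using available_blocked[OF f(1)] by blast
qed auto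

section \<open>Progress and termination of the rounds\<close>

lemma state_Suc_finished: "finished n \<Longrightarrow> state (Suc n) = state n"
  by (simp add: state_at.simps(2) scheduling_round_def)

lemma time_Suc: "\<not> finished n \<Longrightarrow> time (Suc n) = Min (events n)"
  by (auto simp: state_at.simps(2) scheduling_round_def Let_def next_event_def)

lemma rem_Suc:
  assumes "f \<in> flows I"
  shows "rem (Suc n) f = rem n f - (if f \<in> active n then time (Suc n) - time n else 0)"
proof (cases "finished n")
  case False
  then show ?thesis by (auto simp: state_at.simps(2) scheduling_round_def Let_def)
next
  case True
  then show ?thesis unfolding state_Suc_finished[OF True] by simp
qed

text \<open>No flow is served beyond its size, because the finishing time of each selected flow is
  among the events that bound the round.\<close>

lemma rem_nonneg: "f \<in> flows I \<Longrightarrow> 0 \<le> rem n f"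
proof (induction n)
  case 0
  then show ?case using flow_size_pos by (simp add: less_imp_le)
next
  case (Suc n)
  show ?case
  proof (cases "f \<in> active n")
    case True
    then have nf: "\<not> finished n" using active_rem_pos active_flows by fastforce
    have "time (Suc n) \<le> time n + rem n f"
      unfolding time_Suc[OF nf] using True by (intro Min_le finite_events) auto
    then show ?thesis using rem_Suc[OF Suc.prems, of n] True by simp
  next
    case False
    then show ?thesis using rem_Suc[OF Suc.prems, of n] Suc by simp
  qed
qed

lemma time_Suc_in_events: "\<not> finished n \<Longrightarrow> time (Suc n) \<in> events n"
  using Min_in[OF finite_events events_nonempty[OF rem_nonneg]] time_Suc by simp

lemma time_Suc_le: "\<not> finished n \<Longrightarrow> t \<in> events n \<Longrightarrow> time (Suc n) \<le> t"
  using time_Suc Min_le[OF finite_events] by simp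

lemma time_less_Suc: "\<not> finished n \<Longrightarrow> time n < time (Suc n)"
  using time_Suc_in_events active_rem_pos by fastforce

lemma time_le_Suc: "time n \<le> time (Suc n)"
proof (cases "finished n")
  case True
  then show ?thesis unfolding state_Suc_finished[OF True] by simp
qed (use time_less_Suc[of n] in simp)

lemma time_mono: "m \<le> n \<Longrightarrow> time m \<le> time n"
  by (rule lift_Suc_mono_le[of time]) (use time_le_Suc in auto)

lemma rem_Suc_le: "f \<in> flows I \<Longrightarrow> rem (Suc n) f \<le> rem n f"
  using rem_Suc[of f n] time_le_Suc[of n] by auto

lemma rem_antimono: "f \<in> flows I \<Longrightarrow> m \<le> n \<Longrightarrow> rem n f \<le> rem m f"
  by (rule lift_Suc_antimono_le[of "\<lambda>n. rem n f"]) (use rem_Suc_le in auto)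

lemma rem_le_size: "f \<in> flows I \<Longrightarrow> rem n f \<le> flow_size I f"
  using rem_antimono[of f 0 n] by simp

definition pending :: "nat \<Rightarrow> nat" where
  "pending n = card {f \<in> flows I. 0 < rem n f} + card {t \<in> release I ` coflows I. time n < t}"

text \<open>Every round ends with the completion of a flow or with a release.\<close>

lemma pending_less:
  assumes nf: "\<not> finished n"
  shows "pending (Suc n) < pending n"
proof -
  let ?F = "\<lambda>n. {f \<in> flows I. 0 < rem n f}" and ?T = "\<lambda>n. {t \<in> release I ` coflows I. time n < t}"
  have F: "?F (Suc n) \<subseteq> ?F n"
  proof
    fix f assume f: "f \<in> ?F (Suc n)"
    then show "f \<in> ?F n" using rem_Suc_le[of f n] by simp
  qed
  have T: "?T (Suc n) \<subseteq> ?T n" using time_less_Suc[OF nf] by force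
  have "?F (Suc n) \<subset> ?F n \<or> ?T (Suc n) \<subset> ?T n"
  proof (cases "time (Suc n) \<in> ?T n")
    case True
    moreover have "time (Suc n) \<notin> ?T (Suc n)" by simp
    ultimately show ?thesis using T by blast
  next
    case False
    then obtain f where f: "f \<in> active n" "time (Suc n) = time n + rem n f"
      using time_Suc_in_events[OF nf] by auto
    then have "f \<in> ?F n" using active_rem_pos active_flows by auto
    moreover have "f \<notin> ?F (Suc n)" using rem_Suc[OF active_flows[OF f(1)], of n] f by simp
    ultimately show ?thesis using F by blast
  qed
  then show ?thesis
  proof
    assume "?F (Suc n) \<subset> ?F n"
    then have "card (?F (Suc n)) < card (?F n)" by (intro psubset_card_mono) auto
    moreover have "card (?T (Suc n)) \<le> card (?T n)" using T by (intro card_mono) auto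
    ultimately show ?thesis unfolding pending_def by linarith
  next
    assume "?T (Suc n) \<subset> ?T n"
    then have "card (?T (Suc n)) < card (?T n)" by (intro psubset_card_mono) auto
    moreover have "card (?F (Suc n)) \<le> card (?F n)" using F by (intro card_mono) auto
    ultimately show ?thesis unfolding pending_def by linarith
  qed
qed

lemma eventually_finished: "\<exists>N. finished N"
proof -
  have "\<exists>N. finished N" for n :: nat
  proof (induction "pending n" arbitrary: n rule: less_induct)
    case less
    then show ?case using pending_less[of n] by blast
  qed
  then show ?thesis .
qed

lemma finished_state:
  assumes "finished N" "N \<le> n"
  shows "state n = state N"
  using assms(2)
proof (induction n rule: dec_induct)
  case (step n)
  then show ?case using state_Suc_finished[of n] assms(1) by simp
qed simp

section \<open>The list schedule is feasible\<close>

lemma interval_unique: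
  assumes "time m \<le> t" "t < time (Suc m)" "time n \<le> t" "t < time (Suc n)"
  shows "m = n"
proof (rule ccontr)
  assume "m \<noteq> n"
  then have "Suc m \<le> n \<or> Suc n \<le> m" by auto
  then show False using time_mono[of "Suc m" n] time_mono[of "Suc n" m] assms by auto
qed

lemma schedule_nonzero:
  assumes "schedule f t \<noteq> 0"
  obtains n where "time n \<le> t" "t < time (Suc n)" "f \<in> active n"
proof -
  have "\<exists>n. time n \<le> t \<and> t < time (Suc n) \<and> f \<in> active n"
  proof (rule ccontr)
    assume "\<not> ?thesis"
    then have "schedule f t = 0" unfolding list_schedule_def by (rule if_not_P)
    with assms show False ..
  qed
  then show ?thesis using that by blast
qed

lemma schedule_outside:
  assumes "\<And>n. \<not> (time n \<le> t \<and> t < time (Suc n))"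
  shows "schedule f t = 0"
  using schedule_nonzero assms by metis

lemma schedule_in_round:
  assumes n: "time n \<le> t" "t < time (Suc n)"
  shows "schedule f t = (if f \<in> active n then 1 else 0)"
proof -
  have "m = n" if "time m \<le> t" "t < time (Suc m)" for m
    using interval_unique[OF that n] .
  then have "(\<exists>m. time m \<le> t \<and> t < time (Suc m) \<and> f \<in> active m) \<longleftrightarrow> f \<in> active n"
    using n by metis
  then show ?thesis unfolding list_schedule_def by (rule if_cong) simp_all
qed

lemma schedule_nonneg: "0 \<le> schedule f t"
  unfolding list_schedule_def by simp

lemma schedule_before:
  assumes "t < time 0" shows "schedule f t = 0"
proof (rule schedule_outside)
  fix n show "\<not> (time n \<le> t \<and> t < time (Suc n))" using time_mono[of 0 n] assms by simp
qed

lemma schedule_after: "finished N \<Longrightarrow> time N \<le> t \<Longrightarrow> schedule f t = 0"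
proof (rule schedule_outside)
  fix n assume N: "finished N" "time N \<le> t"
  show "\<not> (time n \<le> t \<and> t < time (Suc n))"
  proof (cases "N \<le> n")
    case True
    then show ?thesis using finished_state[OF N(1), of n] finished_state[OF N(1), of "Suc n"] by simp
  next
    case False
    then show ?thesis using time_mono[of "Suc n" N] N(2) by simp
  qed
qed

text \<open>The flow guarantees that a coflow exists, so that the starting time is the minimum of a
  nonempty set of releases.\<close>

lemma time_nonneg:
  assumes "f \<in> flows I" shows "0 \<le> time n"
proof -
  have "release I ` coflows I \<noteq> {}" using coflow_of_in_coflows[OF assms] by auto
  then have "0 \<le> time 0" using release_nonneg by simp
  then show ?thesis using time_mono[of 0 n] by simp
qed

text \<open>Links the states of the algorithm to the rates of the schedule. Stating it with
  \<open>has_integral\<close> yields integrability along with the value.\<close>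

lemma sent_at_time:
  assumes f: "f \<in> flows I"
  shows "(schedule f has_integral (flow_size I f - rem n f)) {0..time n}"
proof (induction n)
  case 0
  have "(schedule f has_integral 0) {0..time 0}"
    by (rule has_integral_spike_finite[of "{time 0}" _ _ "\<lambda>_. 0"]) (auto intro: schedule_before)
  then show ?case by simp
next
  case (Suc n)
  let ?c = "if f \<in> active n then 1 else (0::real)"
  have "((\<lambda>_. ?c) has_integral (?c * (time (Suc n) - time n))) {time n..time (Suc n)}"
    using has_integral_const_real[of ?c "time n" "time (Suc n)"] time_le_Suc[of n]
    by (simp add: mult.commute)
  \<comment> \<open>Rounds are half-open, so the rate is constant except possibly at the right end
    point.\<close>
  then have "(schedule f has_integral (?c * (time (Suc n) - time n))) {time n..time (Suc n)}"
    by (rule has_integral_spike_finite[of "{time (Suc n)}", rotated 2])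
      (auto simp: schedule_in_round)
  from has_integral_combine[OF time_nonneg[OF f] time_le_Suc Suc this]
  moreover have "flow_size I f - rem n f + ?c * (time (Suc n) - time n) = flow_size I f - rem (Suc n) f"
    using rem_Suc[OF f, of n] by simp
  ultimately show ?case by simp
qed

lemma sent_finished:
  assumes f: "f \<in> flows I" and N: "finished N" "time N \<le> t"
  shows "(schedule f has_integral flow_size I f) {0..t}"
proof -
  have "(schedule f has_integral 0) {time N..t}"
    by (rule has_integral_is_0) (use schedule_after[OF N(1)] in auto)
  from has_integral_combine[OF time_nonneg[OF f] N(2) sent_at_time[OF f] this]
  show ?thesis using N(1) f by simp
qed

lemma schedule_integrable:
  assumes f: "f \<in> flows I" shows "schedule f integrable_on {0..t}"
proof -
  obtain N where N: "finished N" using eventually_finished by blast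
  have "schedule f integrable_on {0..max t (time N)}"
    using sent_finished[OF f N] by (rule has_integral_integrable) simp
  then show ?thesis by (rule integrable_on_subinterval) auto
qed

lemma sent_schedule_le:
  assumes f: "f \<in> flows I" shows "sent schedule f t \<le> flow_size I f"
proof -
  obtain N where N: "finished N" using eventually_finished by blast
  have "sent schedule f t \<le> integral {0..max t (time N)} (schedule f)"
    unfolding sent_def using schedule_integrable[OF f] schedule_nonneg
    by (intro integral_subset_le) auto
  also have "\<dots> = flow_size I f" using sent_finished[OF f N, of "max t (time N)"] by (simp add: integral_unique)
  finally show ?thesis .
qed

lemma flow_completion_le_time:
  assumes f: "f \<in> flows I" and "rem n f = 0"
  shows "flow_completion I schedule f \<le> time n"
proof -
  have "sent schedule f (time n) = flow_size I f"
    unfolding sent_def using integral_unique[OF sent_at_time[OF f, of n]] assms(2) by simp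
  then show ?thesis
    unfolding flow_completion_def using time_nonneg[OF f] by (intro cInf_lower bdd_belowI[of _ 0]) auto
qed

text \<open>The algorithm tests completion on its state, whereas feasibility refers to completion
  times of the schedule; this connects the two for the precedence constraints.\<close>

lemma completion_le_time:
  assumes "coflow_completed I (state n) k" "k \<in> coflows I"
  shows "completion I schedule k \<le> time n"
proof (cases "flows_of I k = {}")
  case True
  then have "release I k' \<le> time n \<and> (\<forall>f\<in>flows_of I k'. rem n f = 0)" if "(k', k) \<in> (prec I)\<^sup>*" for k'
    using assms(1) that by (simp add: coflow_completed_def)
  then show ?thesis
    using flow_completion_le_time flow_in_flows_of by (intro completion_leI assms(2)) blast+
next
  case False
  then have "flow_completion I schedule f \<le> time n" if "f \<in> flows_of I k" for f
  proof -
    have "rem n f = 0" using assms(1) that False by (simp add: coflow_completed_def)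
    then show ?thesis using that flow_completion_le_time by (simp add: flows_of_def)
  qed
  then show ?thesis using False by (auto simp: completion_def)
qed

lemma schedule_capacity:
  assumes "q \<in> sides"
  shows "(\<Sum>f | f \<in> flows I \<and> q f = p. schedule f t) \<le> 1"
proof (cases "\<exists>n. time n \<le> t \<and> t < time (Suc n)")
  case True
  then obtain n where n: "time n \<le> t" "t < time (Suc n)" by blast
  have "(\<Sum>f | f \<in> flows I \<and> q f = p. schedule f t) =
      (\<Sum>f | f \<in> flows I \<and> q f = p. if f \<in> active n then 1 else 0)"
    by (simp only: schedule_in_round[OF n])
  also have "\<dots> = real (card {f \<in> active n. q f = p})"
    using active_flows by (subst sum.inter_filter[symmetric]) (auto intro!: arg_cong[where f=card])
  also have "\<dots> \<le> 1"
  proof -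
    have "card {f \<in> active n. q f = p} \<le> 1"
      using active_matching[OF _ _ assms] by (subst card_le_Suc0_iff_eq[unfolded One_nat_def[symmetric]]) auto
    then show ?thesis by simp
  qed
  finally show ?thesis .
next
  case False
  then show ?thesis using schedule_outside by simp
qed

lemma feasible_list_schedule: "feasible_schedule I schedule"
proof -
  obtain N where N: "finished N" using eventually_finished by blast
  have "\<exists>t\<ge>0. sent schedule f t = flow_size I f" if f: "f \<in> flows I" for f
  proof (intro exI conjI)
    show "0 \<le> time N" by (rule time_nonneg[OF f])
    show "sent schedule f (time N) = flow_size I f"
      unfolding sent_def by (rule integral_unique[OF sent_finished[OF f N order.refl]])
  qed
  moreover have "schedule f t = 0" if "f \<in> flows I" "t < release I (coflow_of f)" for f t
  proof (rule ccontr)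
    assume "schedule f t \<noteq> 0"
    then obtain n where "time n \<le> t" "f \<in> active n" by (rule schedule_nonzero)
    then show False using active_available[of f n] that by (simp add: available_def)
  qed
  moreover have "schedule f t = 0"
    if "f \<in> flows I" "(k', coflow_of f) \<in> prec I" "t < completion I schedule k'" for f k' t
  proof (rule ccontr)
    assume "schedule f t \<noteq> 0"
    then obtain n where "time n \<le> t" "f \<in> active n" by (rule schedule_nonzero)
    moreover from this have "coflow_completed I (state n) k'"
      using active_available[of f n] that by (simp add: available_def)
    ultimately show False
      using completion_le_time[of n k'] prec_coflows(1)[OF that(2)] that(3) by simp
  qed
  ultimately show ?thesis
    unfolding feasible_schedule_def
    using schedule_nonneg schedule_integrable sent_schedule_le
      schedule_capacity[of input_of] schedule_capacity[of output_of]
    by (auto simp: sides_def)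
qed

end

section \<open>The approximation bound\<close>

locale priority_run = list_run I ord for I :: "'k coflow_instance" and ord +
  fixes C :: "'k \<Rightarrow> real"
  assumes LP_feasible: "LP_S_feasible I C"
    and priority: "\<And>n. priority_list I C (ord n)"
begin

abbreviation urgent :: "'k \<Rightarrow> 'k set" where "urgent k \<equiv> {l \<in> coflows I. C l \<le> C k}"

lemma C_nonneg: "k \<in> coflows I \<Longrightarrow> 0 \<le> C k"
  using LP_S_nonneg LP_feasible by blast

text \<open>Dropping the individual squares and raising each \<open>C l\<close> to
  \<open>C k\<close> in the set constraint leaves \<open>?L * ?L \<le> ?L * (2 * C k)\<close>.
  Cancelling \<open>?L\<close> explains the factor 2.\<close>

lemma urgent_load_le:
  assumes qp: "q \<in> sides" "p \<in> {1..ports I}" and k: "k \<in> coflows I"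
  shows "(\<Sum>l\<in>urgent k. load I q p l) \<le> 2 * C k"
proof -
  let ?L = "\<Sum>l\<in>urgent k. load I q p l"
  have "1 / 2 * ?L\<^sup>2 \<le> 1 / 2 * ((\<Sum>l\<in>urgent k. (load I q p l)\<^sup>2) + ?L\<^sup>2)"
    by (simp add: sum_nonneg)
  also have "\<dots> \<le> (\<Sum>l\<in>urgent k. load I q p l * C l)"
    using LP_S_feasibleD(3)[OF LP_feasible qp] by simp
  also have "\<dots> \<le> (\<Sum>l\<in>urgent k. load I q p l * C k)"
    by (intro sum_mono mult_left_mono load_nonneg) auto
  also have "\<dots> = ?L * C k" by (simp add: sum_distrib_right)
  finally have "?L * ?L \<le> ?L * (2 * C k)" by (simp add: power2_eq_square)
  moreover have "0 \<le> ?L" by (intro sum_nonneg load_nonneg)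
  ultimately show ?thesis using C_nonneg[OF k] by (cases "?L = 0") auto
qed

text \<open>A potential for the charging argument: the urgent data that has crossed the port of
  \<open>f\<close> since the start of the run, data of \<open>f\<close> included.\<close>

definition urgent_sent :: "'k flow \<Rightarrow> ('k flow \<Rightarrow> nat) \<Rightarrow> nat \<Rightarrow> real" where
  "urgent_sent f q n =
     (\<Sum>g | g \<in> flows I \<and> q g = q f \<and> coflow_of g \<in> urgent (coflow_of f). flow_size I g - rem n g)"

lemma urgent_sent_nonneg: "0 \<le> urgent_sent f q n"
  unfolding urgent_sent_def by (intro sum_nonneg) (simp add: rem_le_size)

lemma urgent_sent_mono: "urgent_sent f q n \<le> urgent_sent f q (Suc n)"
  unfolding urgent_sent_def by (intro sum_mono) (simp add: rem_Suc_le)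

lemma urgent_sent_le:
  assumes f: "f \<in> flows I" and q: "q \<in> sides"
  shows "urgent_sent f q n \<le> 2 * C (coflow_of f)"
proof -
  have "urgent_sent f q n \<le>
      (\<Sum>g | g \<in> flows I \<and> q g = q f \<and> coflow_of g \<in> urgent (coflow_of f). flow_size I g)"
    unfolding urgent_sent_def by (intro sum_mono) (simp add: rem_nonneg)
  also have "\<dots> = (\<Sum>l\<in>urgent (coflow_of f). load I q (q f) l)"
    by (rule sum_load[symmetric]) auto
  also have "\<dots> \<le> 2 * C (coflow_of f)"
    using urgent_load_le[OF q side_in_ports[OF f q] coflow_of_in_coflows[OF f]] .
  finally show ?thesis .
qed

lemma urgent_sent_Suc:
  assumes g: "g \<in> active n" "q g = q f" "coflow_of g \<in> urgent (coflow_of f)"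
  shows "urgent_sent f q n + (time (Suc n) - time n) \<le> urgent_sent f q (Suc n)"
proof -
  let ?G = "{g \<in> flows I. q g = q f \<and> coflow_of g \<in> urgent (coflow_of f)}"
  have "time (Suc n) - time n = rem n g - rem (Suc n) g"
    using rem_Suc[OF active_flows[OF g(1)], of n] g(1) by simp
  also have "\<dots> \<le> (\<Sum>g\<in>?G. rem n g - rem (Suc n) g)"
    using g active_flows[OF g(1)]
    by (intro member_le_sum) (auto simp: rem_Suc_le)
  also have "\<dots> = urgent_sent f q (Suc n) - urgent_sent f q n"
    unfolding urgent_sent_def by (simp add: sum_subtractf)
  finally show ?thesis by simp
qed

text \<open>From the moment \<open>b\<close> on, the flow \<open>f\<close> can only be held up by urgent flows at its two ports.\<close>

lemma round_end_le_urgent: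
  assumes f: "f \<in> flows I"
    and start: "release I (coflow_of f) \<le> b"
    and avail: "\<And>m. b < time (Suc m) \<Longrightarrow> 0 < rem m f \<Longrightarrow> available I (state m) f"
    and "0 < rem n f"
  shows "time (Suc n) \<le> b + urgent_sent f input_of (Suc n) + urgent_sent f output_of (Suc n)"
proof -
  \<comment> \<open>A round that ends by \<open>b\<close> costs nothing. In any later one, including
    a round that straddles \<open>b\<close>, one of the two potentials grows by the full length of
    the round.\<close>
  have step: "time (Suc n) \<le> b + urgent_sent f input_of (Suc n) + urgent_sent f output_of (Suc n)"
    if rem: "0 < rem n f" and prev: "time n \<le> b + urgent_sent f input_of n + urgent_sent f output_of n" for n
  proof (cases "time (Suc n) \<le> b")
    case True
    then show ?thesis
      using urgent_sent_nonneg[of f input_of "Suc n"] urgent_sent_nonneg[of f output_of "Suc n"]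
      by linarith
  next
    case False
    then have "available I (state n) f" using avail rem by simp
    then obtain g q where g: "g \<in> active n" "C (coflow_of g) \<le> C (coflow_of f)" "q \<in> sides" "q g = q f"
      using available_blocked[OF f, of n "\<lambda>f. C (coflow_of f)"] priority[of n]
      by (auto simp: priority_list_def)
    then have "urgent_sent f q n + (time (Suc n) - time n) \<le> urgent_sent f q (Suc n)"
      using coflow_of_in_coflows[OF active_flows[OF g(1)]] by (intro urgent_sent_Suc) auto
    then show ?thesis
      using g(3) prev urgent_sent_mono[of f input_of n] urgent_sent_mono[of f output_of n]
      unfolding sides_def by auto
  qed
  show ?thesis using \<open>0 < rem n f\<close>
  proof (induction n)
    case 0
    have "time 0 \<le> release I (coflow_of f)" using coflow_of_in_coflows[OF f] by simp
    then have "time 0 \<le> b + urgent_sent f input_of 0 + urgent_sent f output_of 0"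
      using start urgent_sent_nonneg[of f input_of 0] urgent_sent_nonneg[of f output_of 0] by linarith
    with 0 show ?case by (rule step)
  next
    case (Suc n)
    then have "0 < rem n f" using rem_Suc_le[OF f, of n] by linarith
    from Suc.prems Suc.IH[OF this] show ?case by (rule step)
  qed
qed

text \<open>Bounding the end of the round has two uses: the end of the last round in which
  \<open>f\<close> is incomplete bounds its completion, and a round that ends too late must already
  start with all ancestors completed.\<close>

lemma incomplete_time_bound:
  assumes "f \<in> flows I" "0 < rem n f"
  shows "time (Suc n) \<le> (1 + 4 * real (depth I (coflow_of f))) * C (coflow_of f)"
  using assms
proof (induction "depth I (coflow_of f)" arbitrary: f n rule: less_induct)
  case less
  define k where "k = coflow_of f"
  have k: "k \<in> coflows I" using coflow_of_in_coflows[OF less.prems(1)] by (simp add: k_def)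
  \<comment> \<open>The bound that the induction hypothesis gives for proper ancestors, with
    \<open>C k\<close> in place of their LP values. As the depth is at least 1, it is also at least
    \<open>C k\<close> and so covers every release.\<close>
  define b where "b = (1 + 4 * (real (depth I k) - 1)) * C k"
  have "1 \<le> real (depth I k)" using depth_pos[OF k] by simp
  then have "1 * C k \<le> b" unfolding b_def using C_nonneg[OF k] by (intro mult_right_mono) auto
  then have released: "release I l \<le> b" if "(l, k) \<in> (prec I)\<^sup>*" for l
    using LP_S_release_le[OF LP_feasible ancestor_coflows[OF that k]]
      LP_S_ancestor_le[OF LP_feasible that] by linarith
  have "available I (state m) f" if m: "b < time (Suc m)" "0 < rem m f" for m
  proof -
    have nf: "\<not> finished m" using m(2) less.prems(1) by force
    \<comment> \<open>A release after the start of round \<open>m\<close> would be an event, ending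
      the round no later than \<open>b\<close>.\<close>
    have rel: "release I l \<le> time m" if l: "(l, k) \<in> (prec I)\<^sup>*" for l
      using time_Suc_le[OF nf, of "release I l"] released[OF l] m(1) ancestor_coflows[OF l k] by force
    have compl: "rem m g = 0" if "g \<in> flows_of I l" and l: "(l, k) \<in> (prec I)\<^sup>+" for g l
    proof (rule ccontr)
      assume "rem m g \<noteq> 0"
      have g: "g \<in> flows I" "coflow_of g = l" using that(1) by (auto simp: flows_of_def)
      have d: "depth I l + 1 \<le> depth I k" using depth_ancestor[OF l] .
      have "0 < rem m g" using rem_nonneg[OF g(1), of m] \<open>rem m g \<noteq> 0\<close> by simp
      \<comment> \<open>The hypothesis is applied to the same round \<open>m\<close>: an incomplete
        ancestor would force the round to end by \<open>b\<close>.\<close>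
      then have "time (Suc m) \<le> (1 + 4 * real (depth I l)) * C l"
        using less.hyps[of g m] g d by (simp add: k_def)
      also have "\<dots> \<le> b"
        unfolding b_def using d C_nonneg LP_S_ancestor_le[OF LP_feasible trancl_into_rtrancl[OF l]]
          ancestor_coflows[OF trancl_into_rtrancl[OF l] k]
        by (intro mult_mono) auto
      finally show False using m(1) by simp
    qed
    have "coflow_completed I (state m) k'" if k': "(k', k) \<in> prec I" for k'
      using rel[OF rtrancl_into_rtrancl[OF _ k']] compl[OF _ rtrancl_into_trancl1[OF _ k']]
      by (rule coflow_completedI)
    then show ?thesis using m(2) rel[of k] unfolding available_def k_def by simp
  qed
  then have "time (Suc n) \<le> b + urgent_sent f input_of (Suc n) + urgent_sent f output_of (Suc n)"
    using released[of k] less.prems by (intro round_end_le_urgent) (auto simp: k_def)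
  also have "\<dots> \<le> b + 2 * C k + 2 * C k"
    using urgent_sent_le[OF less.prems(1), of input_of "Suc n"]
      urgent_sent_le[OF less.prems(1), of output_of "Suc n"] by (simp add: sides_def k_def)
  also have "\<dots> = (1 + 4 * real (depth I k)) * C k"
    by (simp add: b_def algebra_simps)
  finally show ?case by (simp add: k_def)
qed

lemma flow_completion_bound:
  assumes f: "f \<in> flows I"
  shows "flow_completion I schedule f \<le> 5 * real (max_path I) * C (coflow_of f)"
proof -
  let ?k = "coflow_of f"
  obtain N where "finished N" using eventually_finished by blast
  then have ex: "rem N f = 0" using f by simp
  \<comment> \<open>Sizes are positive, so \<open>n\<close> is not 0, and the round before it is the
    last one that starts with \<open>f\<close> incomplete.\<close>
  define n where "n = (LEAST n. rem n f = 0)"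
  have n: "rem n f = 0" unfolding n_def using ex by (rule LeastI)
  have "n \<noteq> 0" using n flow_size_pos[OF f] by (cases n) auto
  then obtain m where m: "n = Suc m" by (cases n) auto
  have "rem m f \<noteq> 0" using not_less_Least[of m "\<lambda>n. rem n f = 0"] m n_def by simp
  then have "0 < rem m f" using rem_nonneg[OF f, of m] by simp
  have k: "?k \<in> coflows I" using coflow_of_in_coflows[OF f] .
  have "flow_completion I schedule f \<le> time (Suc m)"
    using flow_completion_le_time[OF f n] m by simp
  also have "\<dots> \<le> (1 + 4 * real (depth I ?k)) * C ?k"
    using incomplete_time_bound[OF f \<open>0 < rem m f\<close>] .
  also have "\<dots> \<le> 5 * real (max_path I) * C ?k"
    using depth_pos[OF k] depth_le_max_path[OF k] C_nonneg[OF k] by (intro mult_right_mono) auto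
  finally show ?thesis .
qed

lemma completion_bound:
  assumes k: "k \<in> coflows I"
  shows "completion I schedule k \<le> 5 * real (max_path I) * C k"
proof (rule completion_leI[OF k])
  fix f assume f: "f \<in> flows I" "(coflow_of f, k) \<in> (prec I)\<^sup>*"
  have "5 * real (max_path I) * C (coflow_of f) \<le> 5 * real (max_path I) * C k"
    using LP_S_ancestor_le[OF LP_feasible f(2)] by (intro mult_left_mono) auto
  then show "flow_completion I schedule f \<le> 5 * real (max_path I) * C k"
    using flow_completion_bound[OF f(1)] by simp
next
  fix l assume l: "(l, k) \<in> (prec I)\<^sup>*"
  have "1 * C k \<le> 5 * real (max_path I) * C k"
    using depth_pos[OF k] depth_le_max_path[OF k] C_nonneg[OF k] by (intro mult_right_mono) auto
  then show "release I l \<le> 5 * real (max_path I) * C k"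
    using LP_S_release_le[OF LP_feasible ancestor_coflows[OF l k]] LP_S_ancestor_le[OF LP_feasible l]
    by simp
qed

lemma total_weighted_completion_bound:
  "total_weighted_completion I schedule \<le> 5 * real (max_path I) * (\<Sum>k\<in>coflows I. weight I k * C k)"
  unfolding total_weighted_completion_def sum_distrib_left
  using completion_bound weight_nonneg
  by (intro sum_mono) (simp add: mult_left_mono mult.left_commute)

end

section \<open>Existence of a run, and the conclusion\<close>

lemma priority_list_exists:
  assumes "valid_instance I"
  shows "\<exists>fs. priority_list I C fs"
proof -
  interpret coflow I using assms by (rule coflow.intro)
  obtain fs where "set fs = flows I" "distinct fs"
    using finite_distinct_list[OF finite_flows] by blast
  then have "priority_list I C (sort_key (\<lambda>f. C (coflow_of f)) fs)"
    by (simp add: priority_list_def)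
  then show ?thesis ..
qed

theorem theorem5:
  shows "approximation_ratio_at_most
           (single_network_core_list_scheduling :: 'k coflow_instance \<Rightarrow> 'k schedule set)
           (\<lambda>I. 5 * real (max_path I))"
  unfolding approximation_ratio_at_most_def
proof (intro allI impI conjI ballI)
  fix I :: "'k coflow_instance"
  assume valid: "valid_instance I"
  then interpret coflow I by (rule coflow.intro)
  obtain C where "LP_S_optimal I C" using LP_S_optimal_exists by blast
  moreover obtain fs where "priority_list I C fs" using priority_list_exists[OF valid] by blast
  ultimately have "list_schedule I (\<lambda>_. fs) \<in> single_network_core_list_scheduling I"
    unfolding single_network_core_list_scheduling_def by blast
  then show "single_network_core_list_scheduling I \<noteq> {}" by blast
next
  fix I :: "'k coflow_instance" and x
  assume valid: "valid_instance I" and x: "x \<in> single_network_core_list_scheduling I"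
  then obtain C ord where x_eq: "x = list_schedule I ord" and C: "LP_S_optimal I C"
    and ord: "\<And>n. priority_list I C (ord n)"
    unfolding single_network_core_list_scheduling_def by blast
  interpret priority_run I ord C
    using valid C ord by unfold_locales (auto simp: LP_S_optimal_def priority_list_def)
  show feas: "feasible_schedule I x" unfolding x_eq by (rule feasible_list_schedule)
  have "total_weighted_completion I x \<le> 5 * real (max_path I) * (\<Sum>k\<in>coflows I. weight I k * C k)"
    unfolding x_eq by (rule total_weighted_completion_bound)
  also have "\<dots> \<le> 5 * real (max_path I) * optimal_value I"
    using LP_S_optimal_le_optimal_value[OF C feas] by (intro mult_left_mono) auto
  finally show "total_weighted_completion I x \<le> 5 * real (max_path I) * optimal_value I" .
qed

end
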